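(* Let $\mathcal{D}=(D,Q)$ be a discriminant form of even signature with a fixed Jordan splitting. Suppose one of the following holds: (i) there is an odd prime $p$ such that the $p^1$-rank of $D$ is $\geq 7$; (ii) there is an odd prime $p$ and $j>1$ such that the $p^j$-rank of $D$ is $\geq 4$; (iii) for $j=1$ or $j=2$ the even $2^j$-rank $e_j$ and the odd $2^j$-rank $o_j$ satisfy $e_j+o_j\geq 9$; (iv) for some $j\geq 3$ one has $e_j+o_j\geq 5$. Then every vector valued modular form for $\mathcal{D}$ is an oldform: for every $k\in\mathbb{Z}$ and every $F\in M_k(\mathcal{D})$ there exist $G_H\in M_k(\mathcal{D}_H)$, one for each isotropic subgroup $H$ of $D$, with $F=\sum_H G_H\!\uparrow_H$.
   Context: A discriminant form $\mathcal{D}=(D,Q)$ is a finite abelian group $D$ with a map $Q:D\to\mathbb{Q}/\mathbb{Z}$ such that $Q(a\gamma)=a^2Q(\gamma)$ for $a\in\mathbb{Z}$ and $(\gamma,\delta):=Q(\gamma+\delta)-Q(\gamma)-Q(\delta)$ is a nondegenerate $\mathbb{Z}$-bilinear form. Write $e(x)=\exp(2\pi ix)$; the signature $\operatorname{sign}(\mathcal{D})\in\mathbb{Z}/8\mathbb{Z}$ is defined by $\sum_{\gamma}e(Q(\gamma))=\sqrt{|D|}e(\operatorname{sign}(\mathcal{D})/8)$. A Jordan splitting is a decomposition of $D$ as an orthogonal direct sum of components of the following types: (1) $\mathbb{Z}/p^j\mathbb{Z}$, $p$ odd prime, generated by $\gamma$ with $(\gamma,\gamma)=a/p^j$, $\gcd(a,p)=1$;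 (2) (odd $2$-adic) $\mathbb{Z}/2^j\mathbb{Z}$ generated by $\gamma$ with $(\gamma,\gamma)=a/2^j$, $a$ odd; (3) (even $2$-adic) $\mathbb{Z}/2^j\mathbb{Z}\times\mathbb{Z}/2^j\mathbb{Z}$ generated by $\gamma,\delta$ with Gram matrix of $(\cdot,\cdot)$ equal to $2^{-j}\begin{pmatrix}x&1\\1&x\end{pmatrix}$, $x\in\{0,2\}$. Every discriminant form has a Jordan splitting. The $p^j$-rank ($p$ odd) is the number of components of type (1) isomorphic to $\mathbb{Z}/p^j\mathbb{Z}$; the odd $2^j$-rank $o_j$ is the number of type (2) components of order $2^j$; the even $2^j$-rank $e_j$ is the number of type (3) components with exponent $2^j$. Weil representation: on $\mathbb{C}[D]$ with basis $(\mathfrak{e}_\gamma)$, $\rho(T)\mathfrak{e}_\gamma=e(Q(\gamma))\mathfrak{e}_\gamma$, $\rho(S)\mathfrak{e}_\gamma=\frac{e(-\operatorname{sign}(\mathcal{D})/8)}{\sqrt{|D|}}\sum_\beta e(-(\gamma,\beta))\mathfrak{e}_\beta$ for $T=\begin{pmatrix}1&1\\0&1\end{pmatrix}$, $S=\begin{pmatrix}0&-1\\1&0\end{pmatrix}$. $M_k(\mathcal{D})$ is the space of holomorphic $F:\mathbb{H}\to\mathbb{C}[D]$ with $F(M\tau)=(c\tau+d)^k\rho(M)F(\tau)$ for all $M=\begin{pmatrix}a&b\\c&d\end{pmatrix}\in\mathrm{SL}_2(\mathbb{Z})$ and bounded as $\operatorname{Im}\tau\to\infty$. An isotropic subgroup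 $H$ satisfies $Q(H)=0$; $H^\perp=\{\gamma:(\gamma,H)=0\}$, $\mathcal{D}_H=(H^\perp/H,Q_H)$, $Q_H(\gamma+H)=Q(\gamma)$. For $G=\sum_\alpha G_\alpha\mathfrak{e}_\alpha\in M_k(\mathcal{D}_H)$, $G\!\uparrow_H:=\sum_{\gamma\in H^\perp}G_{\gamma+H}\mathfrak{e}_\gamma$. *)

theory Defs
  imports
    "HOL-Analysis.Analysis"
    "HOL-Algebra.Generated_Groups"
    "HOL-Algebra.Multiplicative_Group"
begin

section \<open>The group of rationals modulo integers\<close>

quotient_type rat_mod_int = rat / "\<lambda>x y :: rat. x - y \<in> \<int>"
  morphisms rep_rmi rmi
proof (rule equivpI)
  show "reflp (\<lambda>x y :: rat. x - y \<in> \<int>)"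
    by (simp add: reflp_def)
  show "symp (\<lambda>x y :: rat. x - y \<in> \<int>)"
    unfolding symp_def by (metis Ints_minus minus_diff_eq)
  show "transp (\<lambda>x y :: rat. x - y \<in> \<int>)"
    unfolding transp_def by (metis Ints_add diff_add_cancel add_diff_eq)
qed

instantiation rat_mod_int :: ab_group_add
begin

lift_definition zero_rat_mod_int :: rat_mod_int is "0 :: rat" .

lift_definition plus_rat_mod_int :: "rat_mod_int \<Rightarrow> rat_mod_int \<Rightarrow> rat_mod_int"
  is "(+)"
  by (metis Ints_add add_diff_add)

lift_definition uminus_rat_mod_int :: "rat_mod_int \<Rightarrow> rat_mod_int"
  is "uminus"
  by (metis Ints_minus minus_diff_minus)

lift_definition minus_rat_mod_int :: "rat_mod_int \<Rightarrow> rat_mod_int \<Rightarrow> rat_mod_int"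
  is "(-)"
  by (metis Ints_diff diff_diff_eq2 diff_add_eq add_diff_eq add.commute diff_diff_eq)

instance
  by standard (transfer; simp add: algebra_simps)+

end

lift_definition int_scale :: "int \<Rightarrow> rat_mod_int \<Rightarrow> rat_mod_int"
  is "\<lambda>a x. of_int a * x"
  by (metis Ints_mult Ints_of_int right_diff_distrib)

definition e_real :: "real \<Rightarrow> complex"
  where "e_real x = exp (2 * of_real pi * \<i> * of_real x)"

lift_definition e_rmi :: "rat_mod_int \<Rightarrow> complex"
  is "\<lambda>x. e_real (of_rat x)"
proof -
  fix x y :: rat
  assume "x - y \<in> \<int>"
  then obtain n where "x - y = of_int n"
    by (elim Ints_cases)
  then have "x = y + of_int n"
    by (simp add: algebra_simps)
  then have "2 * of_real pi * \<i> * of_real (of_rat x) =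
      2 * of_real pi * \<i> * of_real (of_rat y) + (of_int (2 * n) * pi) * \<i>"
    by (simp add: of_rat_add algebra_simps)
  then show "e_real (of_rat x) = e_real (of_rat y)"
    unfolding e_real_def using exp_eq by blast
qed


section \<open>Discriminant forms\<close>

text \<open>The group is written multiplicatively, as usual for \<^const>\<open>comm_group\<close>.\<close>

definition bform :: "'a monoid \<Rightarrow> ('a \<Rightarrow> rat_mod_int) \<Rightarrow> 'a \<Rightarrow> 'a \<Rightarrow> rat_mod_int"
  where "bform D Q \<gamma> \<delta> = Q (\<gamma> \<otimes>\<^bsub>D\<^esub> \<delta>) - Q \<gamma> - Q \<delta>"

locale discriminant_form = comm_group D for D :: "'a monoid" (structure) +
  fixes Q :: "'a \<Rightarrow> rat_mod_int"
  assumes finite_carrier: "finite (carrier D)"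
    and Q_pow: "\<And>(a :: int) \<gamma>. \<gamma> \<in> carrier D \<Longrightarrow> Q (\<gamma> [^] a) = int_scale (a\<^sup>2) (Q \<gamma>)"
    and bform_left: "\<And>\<gamma> \<gamma>' \<delta>. \<lbrakk>\<gamma> \<in> carrier D; \<gamma>' \<in> carrier D; \<delta> \<in> carrier D\<rbrakk>
      \<Longrightarrow> bform D Q (\<gamma> \<otimes> \<gamma>') \<delta> = bform D Q \<gamma> \<delta> + bform D Q \<gamma>' \<delta>"
    and bform_right: "\<And>\<gamma> \<delta> \<delta>'. \<lbrakk>\<gamma> \<in> carrier D; \<delta> \<in> carrier D; \<delta>' \<in> carrier D\<rbrakk>
      \<Longrightarrow> bform D Q \<gamma> (\<delta> \<otimes> \<delta>') = bform D Q \<gamma> \<delta> + bform D Q \<gamma> \<delta>'"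
    and nondegenerate: "\<And>\<gamma>. \<lbrakk>\<gamma> \<in> carrier D; \<And>\<delta>. \<delta> \<in> carrier D \<Longrightarrow> bform D Q \<gamma> \<delta> = 0\<rbrakk>
      \<Longrightarrow> \<gamma> = \<one>"

text \<open>The signature is a class modulo 8: \<open>has_signature D Q s\<close> says that \<open>s\<close> is a
  representative of it, and \<open>signature D Q\<close> is the representative in \<open>{0..<8}\<close>.\<close>

definition has_signature :: "'a monoid \<Rightarrow> ('a \<Rightarrow> rat_mod_int) \<Rightarrow> int \<Rightarrow> bool"
  where "has_signature D Q s \<longleftrightarrow>
    (\<Sum>\<gamma>\<in>carrier D. e_rmi (Q \<gamma>)) =
      of_real (sqrt (real (card (carrier D)))) * e_real (of_int s / 8)"

definition signature :: "'a monoid \<Rightarrow> ('a \<Rightarrow> rat_mod_int) \<Rightarrow> int"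
  where "signature D Q = (THE s. s \<in> {0..<8} \<and> has_signature D Q s)"

definition even_signature :: "'a monoid \<Rightarrow> ('a \<Rightarrow> rat_mod_int) \<Rightarrow> bool"
  where "even_signature D Q \<longleftrightarrow> (\<exists>s. has_signature D Q s \<and> even s)"


section \<open>Jordan splittings\<close>

text \<open>\<open>Odd_Prime p j \<gamma>\<close> is cyclic of order \<open>p ^ j\<close>; the numbers in the other two constructors
  are exponents \<open>j\<close> of \<open>2 ^ j\<close>. The remaining arguments are the distinguished generators.\<close>

datatype 'a jordan_component =
    Odd_Prime nat nat 'a
  | Odd_Two nat 'a
  | Even_Two nat 'a 'a

fun component_gens :: "'a jordan_component \<Rightarrow> 'a set"
  where
    "component_gens (Odd_Prime p j \<gamma>) = {\<gamma>}"
  | "component_gens (Odd_Two j \<gamma>) = {\<gamma>}"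
  | "component_gens (Even_Two j \<gamma> \<delta>) = {\<gamma>, \<delta>}"

definition component_group :: "'a monoid \<Rightarrow> 'a jordan_component \<Rightarrow> 'a set"
  where "component_group D c = generate D (component_gens c)"

fun jordan_component_ok ::
    "'a monoid \<Rightarrow> ('a \<Rightarrow> rat_mod_int) \<Rightarrow> 'a jordan_component \<Rightarrow> bool"
  where
    "jordan_component_ok D Q (Odd_Prime p j \<gamma>) \<longleftrightarrow>
      prime p \<and> odd p \<and> j \<ge> 1 \<and> \<gamma> \<in> carrier D \<and> group.ord D \<gamma> = p ^ j \<and>
      (\<exists>a :: int. coprime a (int p) \<and> bform D Q \<gamma> \<gamma> = rmi (of_int a / of_nat (p ^ j)))"
  | "jordan_component_ok D Q (Odd_Two j \<gamma>) \<longleftrightarrow>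
      j \<ge> 1 \<and> \<gamma> \<in> carrier D \<and> group.ord D \<gamma> = 2 ^ j \<and>
      (\<exists>a :: int. odd a \<and> bform D Q \<gamma> \<gamma> = rmi (of_int a / 2 ^ j))"
  | "jordan_component_ok D Q (Even_Two j \<gamma> \<delta>) \<longleftrightarrow>
      j \<ge> 1 \<and> \<gamma> \<in> carrier D \<and> \<delta> \<in> carrier D \<and>
      group.ord D \<gamma> = 2 ^ j \<and> group.ord D \<delta> = 2 ^ j \<and>
      generate D {\<gamma>} \<inter> generate D {\<delta>} = {\<one>\<^bsub>D\<^esub>} \<and>
      (\<exists>x \<in> {0, 2}. bform D Q \<gamma> \<gamma> = rmi (x / 2 ^ j) \<and> bform D Q \<delta> \<delta> = rmi (x / 2 ^ j) \<and>
        bform D Q \<gamma> \<delta> = rmi (1 / 2 ^ j))"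

definition jordan_splitting ::
    "'a monoid \<Rightarrow> ('a \<Rightarrow> rat_mod_int) \<Rightarrow> 'a jordan_component list \<Rightarrow> bool"
  where "jordan_splitting D Q cs \<longleftrightarrow>
    (\<forall>c \<in> set cs. jordan_component_ok D Q c) \<and>
    (\<forall>i < length cs. \<forall>k < length cs. i \<noteq> k \<longrightarrow>
      (\<forall>x \<in> component_group D (cs ! i). \<forall>y \<in> component_group D (cs ! k). bform D Q x y = 0)) \<and>
    bij_betw (\<lambda>f. finprod D f {..<length cs})
      (\<Pi>\<^sub>E i \<in> {..<length cs}. component_group D (cs ! i)) (carrier D)"

definition odd_prime_rank :: "'a jordan_component list \<Rightarrow> nat \<Rightarrow> nat \<Rightarrow> nat"
  where "odd_prime_rank cs p j = length (filter (\<lambda>c. \<exists>\<gamma>. c = Odd_Prime p j \<gamma>) cs)"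

definition odd_two_rank :: "'a jordan_component list \<Rightarrow> nat \<Rightarrow> nat"
  where "odd_two_rank cs j = length (filter (\<lambda>c. \<exists>\<gamma>. c = Odd_Two j \<gamma>) cs)"

definition even_two_rank :: "'a jordan_component list \<Rightarrow> nat \<Rightarrow> nat"
  where "even_two_rank cs j = length (filter (\<lambda>c. \<exists>\<gamma> \<delta>. c = Even_Two j \<gamma> \<delta>) cs)"


section \<open>Weil representation and vector valued modular forms\<close>

text \<open>Elements of the group algebra are functions vanishing outside the carrier.\<close>

definition group_algebra :: "'a monoid \<Rightarrow> ('a \<Rightarrow> complex) set"
  where "group_algebra D = {v. \<forall>\<gamma>. \<gamma> \<notin> carrier D \<longrightarrow> v \<gamma> = 0}"

definition basis_vec :: "'a \<Rightarrow> 'a \<Rightarrow> complex"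
  where "basis_vec \<gamma> = (\<lambda>\<beta>. if \<beta> = \<gamma> then 1 else 0)"

definition SL2Z :: "(int ^ 2 ^ 2) set"
  where "SL2Z = {M. det M = 1}"

definition T_mat :: "int ^ 2 ^ 2"
  where "T_mat = vector [vector [1, 1], vector [0, 1]]"

definition S_mat :: "int ^ 2 ^ 2"
  where "S_mat = vector [vector [0, -1], vector [1, 0]]"

text \<open>Since \<open>S\<close> and \<open>T\<close> generate the modular group, these conditions determine \<open>\<rho> M v\<close>
  for all \<open>M \<in> SL2Z\<close> and \<open>v \<in> group_algebra D\<close>.\<close>

definition weil_representation ::
    "'a monoid \<Rightarrow> ('a \<Rightarrow> rat_mod_int) \<Rightarrow>
      (int ^ 2 ^ 2 \<Rightarrow> ('a \<Rightarrow> complex) \<Rightarrow> ('a \<Rightarrow> complex)) \<Rightarrow> bool"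
  where "weil_representation D Q \<rho> \<longleftrightarrow>
    (\<forall>M \<in> SL2Z. \<forall>v \<in> group_algebra D. \<rho> M v \<in> group_algebra D) \<and>
    (\<forall>M \<in> SL2Z. \<forall>v \<in> group_algebra D. \<forall>w \<in> group_algebra D. \<forall>a b.
      \<rho> M (\<lambda>\<gamma>. a * v \<gamma> + b * w \<gamma>) = (\<lambda>\<gamma>. a * \<rho> M v \<gamma> + b * \<rho> M w \<gamma>)) \<and>
    (\<forall>v \<in> group_algebra D. \<rho> (mat 1) v = v) \<and>
    (\<forall>M \<in> SL2Z. \<forall>N \<in> SL2Z. \<forall>v \<in> group_algebra D. \<rho> (M ** N) v = \<rho> M (\<rho> N v)) \<and>
    (\<forall>\<gamma> \<in> carrier D. \<rho> T_mat (basis_vec \<gamma>) = (\<lambda>\<beta>. e_rmi (Q \<gamma>) * basis_vec \<gamma> \<beta>)) \<and>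
    (\<forall>\<gamma> \<in> carrier D. \<rho> S_mat (basis_vec \<gamma>) =
      (\<lambda>\<alpha>. e_real (- of_int (signature D Q) / 8) / of_real (sqrt (real (card (carrier D)))) *
        (\<Sum>\<beta>\<in>carrier D. e_rmi (- bform D Q \<gamma> \<beta>) * basis_vec \<beta> \<alpha>)))"

definition upper_half_plane :: "complex set"
  where "upper_half_plane = {\<tau>. Im \<tau> > 0}"

definition modular_forms ::
    "int \<Rightarrow> 'a monoid \<Rightarrow> ('a \<Rightarrow> rat_mod_int) \<Rightarrow> (complex \<Rightarrow> 'a \<Rightarrow> complex) set"
  where "modular_forms k D Q = {F.
    (\<forall>\<tau> \<in> upper_half_plane. F \<tau> \<in> group_algebra D) \<and>
    (\<forall>\<gamma> \<in> carrier D. (\<lambda>\<tau>. F \<tau> \<gamma>) holomorphic_on upper_half_plane) \<and>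
    (\<exists>\<rho>. weil_representation D Q \<rho> \<and>
      (\<forall>M \<in> SL2Z. \<forall>\<tau> \<in> upper_half_plane.
        F ((of_int (M $ 1 $ 1) * \<tau> + of_int (M $ 1 $ 2)) /
           (of_int (M $ 2 $ 1) * \<tau> + of_int (M $ 2 $ 2))) =
        (\<lambda>\<gamma>. (of_int (M $ 2 $ 1) * \<tau> + of_int (M $ 2 $ 2)) powi k * \<rho> M (F \<tau>) \<gamma>))) \<and>
    (\<exists>B y. \<forall>\<tau> \<in> upper_half_plane. Im \<tau> > y \<longrightarrow> (\<forall>\<gamma> \<in> carrier D. norm (F \<tau> \<gamma>) \<le> B))}"


section \<open>Isotropic subgroups and lifts\<close>

definition isotropic :: "'a monoid \<Rightarrow> ('a \<Rightarrow> rat_mod_int) \<Rightarrow> 'a set \<Rightarrow> bool"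
  where "isotropic D Q H \<longleftrightarrow> subgroup H D \<and> (\<forall>\<gamma> \<in> H. Q \<gamma> = 0)"

definition perp :: "'a monoid \<Rightarrow> ('a \<Rightarrow> rat_mod_int) \<Rightarrow> 'a set \<Rightarrow> 'a set"
  where "perp D Q H = {\<gamma> \<in> carrier D. \<forall>\<delta> \<in> H. bform D Q \<gamma> \<delta> = 0}"

definition quot_group :: "'a monoid \<Rightarrow> ('a \<Rightarrow> rat_mod_int) \<Rightarrow> 'a set \<Rightarrow> 'a set monoid"
  where "quot_group D Q H = D\<lparr>carrier := perp D Q H\<rparr> Mod H"

text \<open>For isotropic \<open>H\<close>, \<open>Q\<close> is constant on each coset of \<open>H\<close> in its orthogonal complement.\<close>

definition quot_form :: "('a \<Rightarrow> rat_mod_int) \<Rightarrow> 'a set \<Rightarrow> rat_mod_int"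
  where "quot_form Q X = the_elem (Q ` X)"

definition up_lift :: "'a monoid \<Rightarrow> ('a \<Rightarrow> rat_mod_int) \<Rightarrow> 'a set \<Rightarrow>
    (complex \<Rightarrow> 'a set \<Rightarrow> complex) \<Rightarrow> complex \<Rightarrow> 'a \<Rightarrow> complex"
  where "up_lift D Q H G \<tau> =
    (\<lambda>\<alpha>. \<Sum>\<gamma>\<in>perp D Q H. G \<tau> (H #>\<^bsub>D\<^esub> \<gamma>) * basis_vec \<gamma> \<alpha>)"

text \<open>Only nontrivial isotropic subgroups contribute to oldforms: the lift from the trivial
  subgroup is the identity up to the identification of \<open>D\<close> with its quotient by it.\<close>

definition oldform :: "int \<Rightarrow> 'a monoid \<Rightarrow> ('a \<Rightarrow> rat_mod_int) \<Rightarrow> (complex \<Rightarrow> 'a \<Rightarrow> complex) \<Rightarrow> bool"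
  where "oldform k D Q F \<longleftrightarrow>
    (\<exists>G :: 'a set \<Rightarrow> complex \<Rightarrow> 'a set \<Rightarrow> complex.
      (\<forall>H. isotropic D Q H \<and> H \<noteq> {\<one>\<^bsub>D\<^esub>} \<longrightarrow>
        G H \<in> modular_forms k (quot_group D Q H) (quot_form Q)) \<and>
      (\<forall>\<tau> \<in> upper_half_plane.
        F \<tau> = (\<lambda>\<alpha>. \<Sum>H | isotropic D Q H \<and> H \<noteq> {\<one>\<^bsub>D\<^esub>}. up_lift D Q H (G H) \<tau> \<alpha>)))"

end

theory Submission
  imports Defs "HOL-Number_Theory.Cong" "HOL-Library.Function_Algebras"
begin

text \<open>
  Write \<open>\<up>\<^sub>H\<close> for the lift from \<open>\<complex>[H\<^sup>\<bottom>/H]\<close> to \<open>\<complex>[D]\<close> and \<open>\<down>\<^sub>H\<close> for its adjoint. Both intertwine the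
  Weil representations, so the positive operator \<open>P = \<Sum>\<^sub>H \<up>\<^sub>H \<down>\<^sub>H\<close>, with \<open>H\<close> running over the nontrivial
  isotropic subgroups, commutes with the Weil representation. If \<open>P\<close> is injective, then every form
  \<open>F = P (P\<inverse> F)\<close> is the sum of the lifts of \<open>\<down>\<^sub>H P\<inverse> F\<close>.

  The kernel of \<open>P\<close> consists of the \<open>v\<close> killed by all \<open>\<down>\<^sub>H\<close>. If \<open>\<gamma>\<close> is orthogonal to an isotropic
  elementary abelian \<open>p\<close>-group \<open>I\<close> of order greater than \<open>p\<close>, comparing the sums of \<open>v\<close> over \<open>\<gamma> + I\<close>
  and over \<open>\<gamma> + \<langle>u\<rangle>\<close> for \<open>0 \<noteq> u \<in> I\<close> gives \<open>(|I| - p) v(\<gamma>) = 0\<close>. The rank conditions provide such an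
  \<open>I\<close> for every \<open>\<gamma>\<close>, inside \<open>p\<^bsup>j-1\<^esup> D[p\<^bsup>j\<^esup>]\<close>: this group is itself isotropic if \<open>p\<close> is odd and
  \<open>j > 1\<close>, or \<open>p = 2\<close> and \<open>j > 2\<close>, and otherwise quadratic forms in enough variables represent zero.
\<close>

section \<open>Generation of the modular group\<close>

lemma T_mat_entries [simp]:
  "T_mat $ 1 $ 1 = 1" "T_mat $ 1 $ 2 = 1" "T_mat $ 2 $ 1 = 0" "T_mat $ 2 $ 2 = 1"
  by (simp_all add: T_mat_def)

lemma S_mat_entries [simp]:
  "S_mat $ 1 $ 1 = 0" "S_mat $ 1 $ 2 = -1" "S_mat $ 2 $ 1 = 1" "S_mat $ 2 $ 2 = 0"
  by (simp_all add: S_mat_def)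

lemma T_mat_in_SL2Z: "T_mat \<in> SL2Z" and S_mat_in_SL2Z: "S_mat \<in> SL2Z"
  by (simp_all add: SL2Z_def det_2)

lemma mat_1_in_SL2Z: "mat 1 \<in> SL2Z"
  by (simp add: SL2Z_def)

lemma SL2Z_mult: "M \<in> SL2Z \<Longrightarrow> N \<in> SL2Z \<Longrightarrow> M ** N \<in> SL2Z"
  by (simp add: SL2Z_def det_mul)

lemma mat2_eq_iff:
  fixes M N :: "int ^ 2 ^ 2"
  shows "M = N \<longleftrightarrow> M $ 1 $ 1 = N $ 1 $ 1 \<and> M $ 1 $ 2 = N $ 1 $ 2 \<and>
    M $ 2 $ 1 = N $ 2 $ 1 \<and> M $ 2 $ 2 = N $ 2 $ 2"
  by (auto simp: vec_eq_iff forall_2)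

lemma mat2_mult_entry:
  fixes M N :: "int ^ 2 ^ 2"
  shows "(M ** N) $ i $ j = M $ i $ 1 * N $ 1 $ j + M $ i $ 2 * N $ 2 $ j"
  by (simp add: matrix_matrix_mult_def sum_2)

definition T_pow :: "int \<Rightarrow> int ^ 2 ^ 2"
  where "T_pow n = vector [vector [1, n], vector [0, 1]]"

lemma T_pow_entries [simp]:
  "T_pow n $ 1 $ 1 = 1" "T_pow n $ 1 $ 2 = n" "T_pow n $ 2 $ 1 = 0" "T_pow n $ 2 $ 2 = 1"
  by (simp_all add: T_pow_def)

text \<open>\<open>S\<close> and \<open>T\<close> generate the modular group even as a monoid, since
  \<open>S\<close> has order 4 and \<open>T\<inverse> = S\<^sup>3 T S T S\<close>.\<close>

inductive_set ST_monoid :: "(int ^ 2 ^ 2) set"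
  where
    one: "mat 1 \<in> ST_monoid"
  | S: "M \<in> ST_monoid \<Longrightarrow> S_mat ** M \<in> ST_monoid"
  | T: "M \<in> ST_monoid \<Longrightarrow> T_mat ** M \<in> ST_monoid"

lemma ST_monoid_subset: "M \<in> ST_monoid \<Longrightarrow> M \<in> SL2Z"
  by (induction rule: ST_monoid.induct)
    (simp_all add: mat_1_in_SL2Z SL2Z_mult S_mat_in_SL2Z T_mat_in_SL2Z)

lemma ST_monoid_T_pow:
  assumes "M \<in> ST_monoid"
  shows "T_pow n ** M \<in> ST_monoid"
proof (induction n rule: int_induct [where k = 0])
  case base
  have "T_pow 0 ** M = M"
    by (simp add: mat2_eq_iff mat2_mult_entry)
  with assms show ?case by simp
next
  case (step1 i)
  have "T_pow (i + 1) ** M = T_mat ** (T_pow i ** M)"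
    by (simp add: mat2_eq_iff mat2_mult_entry algebra_simps)
  with step1 show ?case by (simp add: ST_monoid.T)
next
  case (step2 i)
  have "T_pow (i - 1) ** M =
      S_mat ** (S_mat ** (S_mat ** (T_mat ** (S_mat ** (T_mat ** (S_mat ** (T_pow i ** M)))))))"
    by (simp add: mat2_eq_iff mat2_mult_entry algebra_simps)
  with step2 show ?case by (simp add: ST_monoid.intros)
qed

text \<open>Euclid's algorithm on the first column: a power of T reduces the upper entry modulo the
  lower one, S exchanges the two up to sign, and the lower left entry shrinks in absolute value
  until it is 0.\<close>

lemma SL2Z_eq_ST_monoid: "SL2Z = ST_monoid"
proof
  show "ST_monoid \<subseteq> SL2Z"
    using ST_monoid_subset by blast
next
  have "M \<in> ST_monoid" if "M \<in> SL2Z" for M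
    using that
  proof (induction "nat \<bar>M $ 2 $ 1\<bar>" arbitrary: M rule: less_induct)
    case less
    define a b c d where defs: "a = M $ 1 $ 1" "b = M $ 1 $ 2" "c = M $ 2 $ 1" "d = M $ 2 $ 2"
    have det: "a * d - b * c = 1"
      using less.prems by (simp add: SL2Z_def det_2 defs)
    show ?case
    proof (cases "c = 0")
      case True
      then have ad: "a * d = 1" using det by simp
      then consider "a = 1" "d = 1" | "a = -1" "d = -1"
        by (auto simp: zmult_eq_1_iff)
      then show ?thesis
      proof cases
        case 1
        then have "M = T_pow b ** mat 1"
          using True by (simp add: mat2_eq_iff defs)
        then show ?thesis by (metis ST_monoid.one ST_monoid_T_pow)
      next
        case 2
        \<comment> \<open>S squared is minus the identity.\<close>
        then have "M = S_mat ** (S_mat ** (T_pow (- b) ** mat 1))"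
          using True by (simp add: mat2_eq_iff mat2_mult_entry defs)
        then show ?thesis by (metis ST_monoid.one ST_monoid.S ST_monoid_T_pow)
      qed
    next
      case False
      define q where "q = a div c"
      define M' where "M' = S_mat ** (T_pow (- q) ** M)"
      have "M' $ 2 $ 1 = a mod c"
        by (simp add: M'_def mat2_mult_entry defs q_def minus_div_mult_eq_mod [symmetric])
      then have "nat \<bar>M' $ 2 $ 1\<bar> < nat \<bar>M $ 2 $ 1\<bar>"
        using False abs_mod_less [of c a] by (simp add: defs)
      moreover have "M' \<in> SL2Z"
        using less.prems by (simp add: M'_def SL2Z_def det_mul) (simp add: det_2)
      ultimately have "M' \<in> ST_monoid"
        using less.hyps by blast
      moreover have "M = T_pow q ** (S_mat ** (S_mat ** (S_mat ** M')))"
        by (simp add: M'_def mat2_eq_iff mat2_mult_entry algebra_simps)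
      ultimately show ?thesis
        by (metis ST_monoid.S ST_monoid_T_pow)
    qed
  qed
  then show "SL2Z \<subseteq> ST_monoid" by blast
qed

text \<open>Reduces intertwining relations to S and T. Inverses need no case of their own, because S
  and T generate the group as a monoid.\<close>

lemma SL2Z_induct [consumes 1, case_names one S T]:
  assumes "M \<in> SL2Z" and "P (mat 1)"
    and "\<And>M. M \<in> SL2Z \<Longrightarrow> P M \<Longrightarrow> P (S_mat ** M)"
    and "\<And>M. M \<in> SL2Z \<Longrightarrow> P M \<Longrightarrow> P (T_mat ** M)"
  shows "P M"
  using assms(1) unfolding SL2Z_eq_ST_monoid
  by (induction rule: ST_monoid.induct) (use assms SL2Z_eq_ST_monoid in auto)

section \<open>Rationals modulo integers\<close>

lemma rmi_eq_iff: "rmi x = rmi y \<longleftrightarrow> x - y \<in> \<int>"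
  by (simp add: rat_mod_int.abs_eq_iff)

lemma rmi_eq_0_iff: "rmi x = 0 \<longleftrightarrow> x \<in> \<int>"
  by (simp add: zero_rat_mod_int_def rmi_eq_iff)

lemma rmi_cases: obtains x where "y = rmi x"
  by (metis Quotient3_abs_rep Quotient3_rat_mod_int)

lemma rmi_add: "rmi x + rmi y = rmi (x + y)"
  by (simp add: plus_rat_mod_int.abs_eq)

lemma int_scale_rmi: "int_scale a (rmi x) = rmi (of_int a * x)"
  by (simp add: int_scale.abs_eq)

lemma int_scale_0_right [simp]: "int_scale a 0 = 0"
  by transfer simp

lemma int_scale_0_left [simp]: "int_scale 0 x = 0"
  by transfer simp

lemma int_scale_1_left [simp]: "int_scale 1 x = x"
  by transfer simp

lemma int_scale_add_right: "int_scale a (x + y) = int_scale a x + int_scale a y"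
  by transfer (simp add: algebra_simps)

lemma int_scale_add_left: "int_scale (a + b) x = int_scale a x + int_scale b x"
  by transfer (simp add: algebra_simps)

lemma int_scale_int_scale: "int_scale a (int_scale b x) = int_scale (a * b) x"
  by transfer (simp add: algebra_simps)

lemma int_scale_dvd: "int_scale a x = 0 \<Longrightarrow> a dvd b \<Longrightarrow> int_scale b x = 0"
  by (metis dvd_def int_scale_0_right int_scale_int_scale mult.commute)

lemma int_scale_gcd:
  assumes "int_scale a x = 0" "int_scale b x = 0"
  shows "int_scale (gcd a b) x = 0"
proof -
  obtain u v where "u * a + v * b = gcd a b"
    using bezout_int by blast
  then show ?thesis
    by (metis assms dvd_triv_right int_scale_dvd int_scale_add_left add_0)
qed

lemma int_scale_eq_0_imp:
  assumes "int_scale (int n) y = 0" "n > 0"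
  shows "\<exists>k \<in> {0..<int n}. y = rmi (of_int k / of_nat n)"
proof -
  obtain x where x: "y = rmi x" by (rule rmi_cases)
  with assms have "of_nat n * x \<in> \<int>"
    by (simp add: int_scale_rmi rmi_eq_0_iff)
  then obtain m where m: "of_nat n * x = of_int m" by (elim Ints_cases)
  then have "x = of_int m / of_nat n"
    using assms(2) by (simp add: field_simps)
  also have "\<dots> = of_int (m div int n) + of_int (m mod int n) / of_nat n"
  proof -
    have "(of_int m :: rat) = of_int (m div int n) * of_nat n + of_int (m mod int n)"
      by (metis mult_div_mod_eq mult.commute of_int_add of_int_mult of_int_of_nat_eq)
    then show ?thesis using assms(2) by (simp add: field_simps)
  qed
  finally have "y = rmi (of_int (m mod int n) / of_nat n)"
    by (simp add: x rmi_eq_iff)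
  moreover have "m mod int n \<in> {0..<int n}"
    using assms(2) by simp
  ultimately show ?thesis by blast
qed

text \<open>Every class killed by n is represented by some k/n with 0 \<le> k < n. The count bounds
  the index of the kernel of an additive map on a group of exponent n.\<close>

lemma card_int_scale_torsion:
  assumes "n > 0"
  shows "finite {y. int_scale (int n) y = 0}" "card {y. int_scale (int n) y = 0} \<le> n"
proof -
  have sub: "{y. int_scale (int n) y = 0} \<subseteq> (\<lambda>k. rmi (of_int k / of_nat n)) ` {0..<int n}"
    using int_scale_eq_0_imp [OF _ assms] by auto
  then show "finite {y. int_scale (int n) y = 0}"
    by (rule finite_subset) simp
  have "card {y. int_scale (int n) y = 0} \<le> card ((\<lambda>k. rmi (of_int k / of_nat n)) ` {0..<int n})"
    using sub by (intro card_mono) auto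
  also have "\<dots> \<le> n"
    using card_image_le [of "{0..<int n}"] by fastforce
  finally show "card {y. int_scale (int n) y = 0} \<le> n" .
qed

lemma e_rmi_rmi: "e_rmi (rmi x) = e_real (of_rat x)"
  by (simp add: e_rmi.abs_eq)

lemma e_real_add: "e_real (x + y) = e_real x * e_real y"
  by (simp add: e_real_def algebra_simps exp_add)

lemma e_rmi_add: "e_rmi (x + y) = e_rmi x * e_rmi y"
  by (cases x rule: rmi_cases, cases y rule: rmi_cases)
    (simp add: e_rmi_rmi rmi_add of_rat_add e_real_add)

lemma e_rmi_0 [simp]: "e_rmi 0 = 1"
  by (simp add: zero_rat_mod_int_def e_rmi_rmi e_real_def)

lemma e_rmi_eq_1_iff: "e_rmi x = 1 \<longleftrightarrow> x = 0"
proof -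
  obtain r where x: "x = rmi r" by (rule rmi_cases)
  show ?thesis
  proof
    assume "e_rmi x = 1"
    then have "exp (2 * of_real pi * \<i> * of_real (of_rat r)) = (1 :: complex)"
      by (simp add: x e_rmi_rmi e_real_def)
    then obtain n :: int where "2 * pi * of_rat r = real_of_int (2 * n) * pi"
      by (auto simp: exp_eq_1)
    then have "of_rat r = (of_rat (of_int n) :: real)"
      by simp
    then have "r = of_int n"
      by (simp only: of_rat_eq_iff)
    then show "x = 0" by (simp add: x rmi_eq_0_iff)
  qed simp
qed

section \<open>Isotropic elements\<close>

text \<open>Equal values at s and t force p to divide (s - t)(s + t), and on this range both factors
  are smaller than p in absolute value.\<close>

lemma inj_on_scaled_squares_mod:
  fixes a c p :: int
  assumes "prime p" "\<not> p dvd a"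
  shows "inj_on (\<lambda>s. (a * s\<^sup>2 + c) mod p) {0..(p - 1) div 2}"
proof (rule inj_onI)
  fix s t :: int
  assume s: "s \<in> {0..(p - 1) div 2}" and t: "t \<in> {0..(p - 1) div 2}"
    and eq: "(a * s\<^sup>2 + c) mod p = (a * t\<^sup>2 + c) mod p"
  have "p dvd (a * s\<^sup>2 + c) - (a * t\<^sup>2 + c)"
    using eq by (simp add: mod_eq_dvd_iff)
  also have "(a * s\<^sup>2 + c) - (a * t\<^sup>2 + c) = a * ((s - t) * (s + t))"
    by (simp add: algebra_simps power2_eq_square)
  finally have "p dvd s - t \<or> p dvd s + t"
    using assms by (simp add: prime_dvd_mult_iff)
  moreover have "p > 1"
    using assms(1) by (rule prime_gt_1_int)
  then have "\<bar>s - t\<bar> < p" "0 \<le> s + t" "s + t < p"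
    using s t by auto
  ultimately have "s - t = 0 \<or> s + t = 0"
    by (metis zdvd_not_zless abs_of_nonneg zdvd_imp_le abs_eq_0_iff dvd_abs_iff
        not_less order_le_less zero_less_abs_iff)
  then show "s = t"
    using s t by auto
qed

text \<open>Pigeonhole: a s^2 + c and - b t^2 each take (p + 1)/2 residues modulo p, too many to be
  disjoint. The third variable is fixed to 1, so the zero of the ternary form is never the trivial
  one.\<close>

lemma ternary_quadratic_zero_mod_prime:
  fixes a b c p :: int
  assumes "prime p" "odd p" "\<not> p dvd a" "\<not> p dvd b"
  shows "\<exists>s t. p dvd a * s\<^sup>2 + b * t\<^sup>2 + c"
proof -
  have p: "p > 1" using assms(1) by (rule prime_gt_1_int)
  define I where "I = {0..(p - 1) div 2}"
  define X where "X = (\<lambda>s. (a * s\<^sup>2 + c) mod p) ` I"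
  \<comment> \<open>The summand 0 gives - b t^2 the shape required by
    \<open>inj_on_scaled_squares_mod\<close>.\<close>
  define Y where "Y = (\<lambda>s. ((- b) * s\<^sup>2 + 0) mod p) ` I"
  have cI: "2 * card I = nat (p + 1)"
    using assms(2) p by (auto simp: I_def elim!: oddE)
  have "card X = card I"
    unfolding X_def I_def using assms by (intro card_image inj_on_scaled_squares_mod) auto
  moreover have "card Y = card I"
    unfolding Y_def I_def using assms by (intro card_image inj_on_scaled_squares_mod) auto
  moreover have sub: "X \<subseteq> {0..<p}" "Y \<subseteq> {0..<p}"
    using p by (auto simp: X_def Y_def)
  moreover have "card (X \<union> Y) \<le> nat p"
    using card_mono [of "{0..<p}" "X \<union> Y"] sub by simp
  moreover have fin: "finite X" "finite Y"
    using sub finite_subset by blast+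
  ultimately have "X \<inter> Y \<noteq> {}"
    using card_Un_disjoint [of X Y] cI p by auto
  then obtain s t where "(a * s\<^sup>2 + c) mod p = ((- b) * t\<^sup>2 + 0) mod p"
    by (auto simp: X_def Y_def)
  then have "p dvd (a * s\<^sup>2 + c) - ((- b) * t\<^sup>2 + 0)"
    by (simp only: mod_eq_dvd_iff)
  then show ?thesis
    by (intro exI [of _ s] exI [of _ t]) (simp add: algebra_simps)
qed

section \<open>Multiples, torsion and orthogonality in a discriminant form\<close>

context discriminant_form
begin

lemma bform_sym:
  "x \<in> carrier D \<Longrightarrow> y \<in> carrier D \<Longrightarrow> bform D Q x y = bform D Q y x"
  by (simp add: bform_def m_comm)

lemma Q_mult: "Q (x \<otimes> y) = Q x + Q y + bform D Q x y"
  by (simp add: bform_def)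

lemma Q_one [simp]: "Q \<one> = 0"
  using Q_pow [of \<one> 0] by simp

lemma bform_one_left [simp]: "x \<in> carrier D \<Longrightarrow> bform D Q \<one> x = 0"
  by (simp add: bform_def)

lemma bform_one_right [simp]: "x \<in> carrier D \<Longrightarrow> bform D Q x \<one> = 0"
  by (simp add: bform_def)

lemma bform_inv_left:
  assumes "x \<in> carrier D" "y \<in> carrier D"
  shows "bform D Q (inv x) y = - bform D Q x y"
  using bform_left [of "inv x" x y] assms by (simp add: add_eq_0_iff2)

lemma bform_nat_pow_left:
  assumes "x \<in> carrier D" "y \<in> carrier D"
  shows "bform D Q (x [^] (n :: nat)) y = int_scale (int n) (bform D Q x y)"
  using assms by (induction n) (simp_all add: bform_left int_scale_add_left add.commute)

lemma bform_nat_pow_right: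
  assumes "x \<in> carrier D" "y \<in> carrier D"
  shows "bform D Q x (y [^] (n :: nat)) = int_scale (int n) (bform D Q x y)"
  using bform_nat_pow_left [of y x n] assms by (simp add: bform_sym)

lemma Q_nat_pow: "x \<in> carrier D \<Longrightarrow> Q (x [^] (n :: nat)) = int_scale ((int n)\<^sup>2) (Q x)"
  using Q_pow [of x "int n"] by (simp add: int_pow_int)

lemma bform_self:
  assumes "x \<in> carrier D"
  shows "bform D Q x x = int_scale 2 (Q x)"
proof -
  have "Q (x \<otimes> x) = Q (x [^] (2 :: nat))"
    using assms by (simp add: numeral_2_eq_2)
  \<comment> \<open>The factor 4 is split so that two copies of \<open>Q x\<close> cancel against
    those in \<open>bform\<close>.\<close>
  also have "\<dots> = int_scale (1 + (1 + 2)) (Q x)"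
    using assms by (simp add: Q_nat_pow)
  also have "\<dots> = Q x + (Q x + int_scale 2 (Q x))"
    by (simp only: int_scale_add_left int_scale_1_left)
  finally show ?thesis
    by (simp add: bform_def)
qed

text \<open>The pairing (x, x) is killed by n, but it equals 2 \<open>Q x\<close>, whence the factor
  2.\<close>

lemma double_exponent_scale_Q:
  assumes "x \<in> carrier D" "x [^] (n :: nat) = \<one>"
  shows "int_scale (2 * int n) (Q x) = 0"
proof -
  have "int_scale (int n) (bform D Q x x) = 0"
    using bform_nat_pow_left [of x x n] assms by simp
  then show ?thesis
    using assms by (simp add: bform_self int_scale_int_scale mult.commute)
qed

text \<open>Both n^2, from Q(nx) = n^2 Q(x), and 2n annihilate \<open>Q x\<close>; for odd n their
  gcd is n.\<close>

lemma odd_exponent_scale_Q: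
  assumes "x \<in> carrier D" "x [^] (n :: nat) = \<one>" "odd n"
  shows "int_scale (int n) (Q x) = 0"
proof -
  have "int_scale ((int n)\<^sup>2) (Q x) = 0"
    using Q_nat_pow [of x n] assms by simp
  then have "int_scale (gcd ((int n)\<^sup>2) (2 * int n)) (Q x) = 0"
    using double_exponent_scale_Q [OF assms(1,2)] by (rule int_scale_gcd)
  moreover have "gcd ((int n)\<^sup>2) (2 * int n) = int n"
  proof -
    have "gcd (int n * int n) (2 * int n) = gcd (int n) 2 * int n"
      by (metis gcd_mult_distrib_int mult.commute abs_of_nat)
    moreover have "gcd (int n) 2 = 1"
      using assms(3) by (simp add: coprime_right_2_iff_odd flip: coprime_iff_gcd_eq_1)
    ultimately show ?thesis by (simp add: power2_eq_square)
  qed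
  ultimately show ?thesis by simp
qed

text \<open>The group A is the union of the fibres of f. There are at most n of them since the
  values are n-torsion, and translation embeds each into the kernel.\<close>

lemma
  assumes A: "subgroup A D"
    and add: "\<And>x y. x \<in> A \<Longrightarrow> y \<in> A \<Longrightarrow> f (x \<otimes> y) = f x + (f y :: rat_mod_int)"
  shows subgroup_kernel: "subgroup {x \<in> A. f x = 0} D"
    and card_le_card_kernel:
      "\<lbrakk>n > 0; \<And>x. x \<in> A \<Longrightarrow> int_scale (int n) (f x) = 0\<rbrakk> \<Longrightarrow> card A \<le> n * card {x \<in> A. f x = 0}"
proof -
  interpret A: subgroup A D by (rule A)
  have f1: "f \<one> = 0"
    using add [of \<one> \<one>] by simp
  have finv: "f (inv x) = - f x" if "x \<in> A" for x
    using add [of "inv x" x] that f1 by (simp add: add_eq_0_iff2)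
  show "subgroup {x \<in> A. f x = 0} D"
    by (rule subgroupI) (auto simp: f1 finv add intro!: exI [of _ \<one>])
  assume n: "n > 0" and tors: "\<And>x. x \<in> A \<Longrightarrow> int_scale (int n) (f x) = 0"
  have finA: "finite A"
    using A.subset finite_carrier by (rule finite_subset)
  have "card A = card (\<Union>y\<in>f ` A. {x \<in> A. f x = y})"
    by (rule arg_cong [of _ _ card]) auto
  also have "\<dots> \<le> (\<Sum>y\<in>f ` A. card {x \<in> A. f x = y})"
    using finA by (intro card_UN_le) simp
  also have "\<dots> \<le> of_nat (card (f ` A)) * card {x \<in> A. f x = 0}"
  proof (rule sum_bounded_above)
    fix y assume "y \<in> f ` A"
    then obtain x0 where x0: "x0 \<in> A" "y = f x0" by blast
    show "card {x \<in> A. f x = y} \<le> card {x \<in> A. f x = 0}"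
    proof (rule card_inj_on_le [where f = "\<lambda>x. x \<otimes> inv x0"])
      show "inj_on (\<lambda>x. x \<otimes> inv x0) {x \<in> A. f x = y}"
        using x0 by (auto intro!: inj_onI)
      show "(\<lambda>x. x \<otimes> inv x0) ` {x \<in> A. f x = y} \<subseteq> {x \<in> A. f x = 0}"
        using x0 by (auto simp: add finv)
    qed (use finA in simp)
  qed
  also have "\<dots> \<le> n * card {x \<in> A. f x = 0}"
  proof -
    have "card (f ` A) \<le> card {y. int_scale (int n) y = 0}"
      using tors card_int_scale_torsion(1) [OF n] by (intro card_mono) auto
    also have "\<dots> \<le> n"
      by (rule card_int_scale_torsion(2) [OF n])
    finally show ?thesis by simp
  qed
  finally show "card A \<le> n * card {x \<in> A. f x = 0}" .
qed

text \<open>One orthogonality condition shrinks a group of exponent n by a factor of at most n. This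
  replaces dimension counts over the field with p elements.\<close>

lemma
  assumes A: "subgroup A D" and "x \<in> carrier D"
  shows subgroup_orthogonal: "subgroup {y \<in> A. bform D Q x y = 0} D"
    and card_le_card_orthogonal:
      "\<lbrakk>n > 0; \<And>y. y \<in> A \<Longrightarrow> y [^] n = \<one>\<rbrakk> \<Longrightarrow> card A \<le> n * card {y \<in> A. bform D Q x y = 0}"
proof -
  interpret A: subgroup A D by (rule A)
  have add: "bform D Q x (y \<otimes> z) = bform D Q x y + bform D Q x z" if "y \<in> A" "z \<in> A" for y z
    using that assms(2) by (simp add: bform_right)
  show "subgroup {y \<in> A. bform D Q x y = 0} D"
    by (rule subgroup_kernel [OF A add])
  assume n: "n > 0" and tors: "\<And>y. y \<in> A \<Longrightarrow> y [^] n = \<one>"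
  have scale: "int_scale (int n) (bform D Q x y) = 0" if "y \<in> A" for y
    using bform_nat_pow_right [of x y n] that assms(2) tors by simp
  show "card A \<le> n * card {y \<in> A. bform D Q x y = 0}"
    by (rule card_le_card_kernel [OF A add n scale])
qed

lemma generate_singleton_nat:
  assumes "x \<in> carrier D"
  shows "generate D {x} = {x [^] (n :: nat) | n. True}"
proof
  show "{x [^] (n :: nat) | n. True} \<subseteq> generate D {x}"
    using assms by (auto simp: generate_pow int_pow_int [symmetric])
  have "group.ord D x > 0"
    using ord_ge_1 [OF finite_carrier assms] by simp
  have "x [^] i \<in> {x [^] (n :: nat) | n. True}" for i :: int
  proof -
    have "x [^] i = x [^] nat (i mod int (ord x))"
      using \<open>group.ord D x > 0\<close> assms
      by (simp add: int_pow_int [symmetric] int_pow_eq) (metis dvd_diff_commute dvd_minus_mod)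
    then show ?thesis by blast
  qed
  then show "generate D {x} \<subseteq> {x [^] (n :: nat) | n. True}"
    using assms by (auto simp: generate_pow)
qed

lemma card_generate_le:
  assumes "x \<in> carrier D" "x [^] (n :: nat) = \<one>" "n > 0"
  shows "card (generate D {x}) \<le> n"
  using assms generate_pow_card [of x] pow_eq_id [of x n] by (auto dest: dvd_imp_le)

section \<open>Isotropic elements and subgroups in elementary abelian groups\<close>

text \<open>For odd \<open>p\<close> a ternary form represents zero modulo \<open>p\<close>.\<close>

lemma isotropic_element_odd:
  assumes p: "prime p" "odd p" and A: "subgroup A D" "\<And>y. y \<in> A \<Longrightarrow> y [^] p = \<one>"
    and x: "x \<in> A" "\<And>y. y \<in> A \<Longrightarrow> bform D Q x y = 0"
    and card: "card A \<ge> p ^ 5"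
  shows "\<exists>y\<in>A - generate D {x}. Q y = 0"
proof -
  interpret A: subgroup A D by (rule A)
  have p1: "p > 1" using p(1) by (rule prime_gt_1_nat)
  have fin: "finite A"
    using A.subset finite_carrier by (rule finite_subset)
  have N: "card (generate D {x}) \<le> p" "finite (generate D {x})"
    using card_generate_le [of x p] x A p1 A.subset generate_incl [of "{x}"] finite_carrier
    by (auto intro: finite_subset)
  \<comment> \<open>The cyclic group of x has at most p elements, so p^2 elements cannot all lie in
    it.\<close>
  have pick: "\<exists>y. y \<in> B - generate D {x}" if "card B \<ge> p ^ 2" for B
  proof -
    have "p < p ^ 2" using p1 by (simp add: power2_eq_square)
    then have "\<not> B \<subseteq> generate D {x}"
      using that N card_mono by (metis le_trans not_le)
    then show ?thesis by blast
  qed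
  have cd: "p ^ 5 = p * p ^ 4" "p ^ 4 = p * p ^ 3" "p ^ 3 = p * p ^ 2"
    by (simp_all add: eval_nat_numeral)
  have "p ^ 2 \<le> p ^ 5" "p ^ 2 \<le> p ^ 4" "p ^ 2 \<le> p ^ 3"
    using p1 by (simp_all add: power_increasing)
  note le = this
  \<comment> \<open>Gram-Schmidt without linear algebra: three pairwise orthogonal elements outside
    the cyclic group of x. Each passage to an orthogonal complement costs a factor p, from p^5 to
    p^4 to p^3.\<close>
  obtain x1 where x1: "x1 \<in> A - generate D {x}"
    using pick [of A] card le by auto
  define A1 where "A1 = {y \<in> A. bform D Q x1 y = 0}"
  have A1: "subgroup A1 D"
    unfolding A1_def using x1 by (intro subgroup_orthogonal A) auto
  have "card A \<le> p * card A1"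
    unfolding A1_def using x1 p1 A(2) by (intro card_le_card_orthogonal A) auto
  then have "p * p ^ 4 \<le> p * card A1"
    using card cd by linarith
  then have cA1: "p ^ 4 \<le> card A1"
    using p1 by simp
  obtain x2 where x2: "x2 \<in> A1 - generate D {x}"
    using pick [of A1] cA1 le by auto
  then have x2A: "x2 \<in> A" by (simp add: A1_def)
  define A2 where "A2 = {y \<in> A1. bform D Q x2 y = 0}"
  have "card A1 \<le> p * card A2"
    unfolding A2_def using x2 x2A p1 A(2)
    by (intro card_le_card_orthogonal A1) (auto simp: A1_def)
  then have "p * p ^ 3 \<le> p * card A2"
    using cA1 cd by linarith
  then have cA2: "p ^ 3 \<le> card A2"
    using p1 by simp
  obtain x3 where x3: "x3 \<in> A2 - generate D {x}"
    using pick [of A2] cA2 le by auto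
  then have x3A: "x3 \<in> A" by (simp add: A1_def A2_def)
  have orth: "bform D Q x1 x2 = 0" "bform D Q x1 x3 = 0" "bform D Q x2 x3 = 0"
    using x2 x3 by (auto simp: A1_def A2_def)
  show ?thesis
  proof (cases "Q x1 = 0 \<or> Q x2 = 0 \<or> Q x3 = 0")
    case True
    then show ?thesis using x1 x2 x3 x2A x3A by blast
  next
    case False
    \<comment> \<open>On A the form takes values in (1/p)Z/Z; a nonzero value has a numerator prime
      to p, as the ternary zero lemma demands.\<close>
    have coeff: "\<exists>a. Q y = rmi (of_int a / of_nat p) \<and> (Q y \<noteq> 0 \<longrightarrow> \<not> int p dvd a)" if y: "y \<in> A" for y
    proof -
      have "int_scale (int p) (Q y) = 0"
        using y A p by (intro odd_exponent_scale_Q) auto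
      then obtain a where a: "Q y = rmi (of_int a / of_nat p)"
        using int_scale_eq_0_imp p1 by (metis zero_less_one less_trans)
      moreover have "Q y = 0" if dvd: "int p dvd a"
      proof -
        from dvd obtain m where "a = int p * m" ..
        then have "of_int a / of_nat p = (of_int m :: rat)"
          using p1 by simp
        then show ?thesis by (simp add: a rmi_eq_0_iff)
      qed
      ultimately show ?thesis by blast
    qed
    obtain a1 a2 a3 where a:
      "Q x1 = rmi (of_int a1 / of_nat p)" "\<not> int p dvd a1"
      "Q x2 = rmi (of_int a2 / of_nat p)" "\<not> int p dvd a2"
      "Q x3 = rmi (of_int a3 / of_nat p)" "\<not> int p dvd a3"
      using coeff [of x1] coeff [of x2] coeff [of x3] x1 x2A x3A False by blast
    obtain s' t' where "int p dvd a1 * s'\<^sup>2 + a2 * t'\<^sup>2 + a3"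
      using ternary_quadratic_zero_mod_prime [of "int p" a1 a2 a3] p a by auto
    \<comment> \<open>The signs vanish in the squares, so natural exponents suffice.\<close>
    moreover define s t where "s = nat \<bar>s'\<bar>" and "t = nat \<bar>t'\<bar>"
    ultimately have "int p dvd a1 * (int s)\<^sup>2 + a2 * (int t)\<^sup>2 + a3"
      by simp
    then obtain m where m: "a1 * (int s)\<^sup>2 + a2 * (int t)\<^sup>2 + a3 = int p * m" ..
    define y where "y = x1 [^] s \<otimes> x2 [^] t \<otimes> x3"
    have carr: "x1 \<in> carrier D" "x2 \<in> carrier D" "x3 \<in> carrier D" "x \<in> carrier D"
      using x1 x2A x3A x by auto
    have powA: "z [^] k \<in> A" if "z \<in> A" for z and k :: nat
      using that by (induction k) auto
    have yA: "y \<in> A"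
      using x1 x2A x3A by (auto simp: y_def intro!: A.m_closed powA)
    have "Q y = int_scale ((int s)\<^sup>2) (Q x1) + int_scale ((int t)\<^sup>2) (Q x2) + Q x3"
      using carr orth by (simp add: y_def Q_mult bform_left bform_nat_pow_left
          bform_nat_pow_right Q_nat_pow)
    also have "\<dots> = rmi (of_int (a1 * (int s)\<^sup>2 + a2 * (int t)\<^sup>2 + a3) / of_nat p)"
      by (simp add: a int_scale_rmi rmi_add add_divide_distrib mult.commute)
    also have "\<dots> = 0"
      unfolding m using p1 by (simp add: rmi_eq_0_iff)
    finally have "Q y = 0" .
    \<comment> \<open>A multiple of x is orthogonal to A, whereas (y, x3) = (x3, x3) = 2
      \<open>Q x3\<close>, which is nonzero because p is odd.\<close>
    moreover have "y \<notin> generate D {x}"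
    proof
      assume "y \<in> generate D {x}"
      then obtain k :: nat where "y = x [^] k"
        using carr by (auto simp: generate_singleton_nat)
      then have "bform D Q y x3 = 0"
        using carr x(2) x3A by (simp add: bform_nat_pow_left)
      moreover have "bform D Q y x3 = bform D Q x3 x3"
        using carr orth by (simp add: y_def bform_left bform_nat_pow_left)
      ultimately have "int_scale 2 (Q x3) = 0"
        using carr by (simp add: bform_self)
      moreover have "int_scale (int p) (Q x3) = 0"
        using x3A A p by (intro odd_exponent_scale_Q) auto
      ultimately have "int_scale (gcd 2 (int p)) (Q x3) = 0"
        by (rule int_scale_gcd)
      moreover have "gcd 2 (int p) = 1"
        using p(2) by (simp flip: coprime_iff_gcd_eq_1)
      ultimately show False using False by simp
    qed
    ultimately show ?thesis using yA by blast
  qed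
qed

text \<open>For \<open>p = 2\<close> the map \<open>2 Q\<close> is additive, and on its kernel \<open>Q\<close> takes only two values.\<close>

lemma isotropic_element_two:
  assumes A: "subgroup A D" "\<And>y. y \<in> A \<Longrightarrow> y [^] (2 :: nat) = \<one>"
    and x: "x \<in> A"
    and card: "card A \<ge> 2 ^ 5"
  shows "\<exists>y\<in>A - generate D {x}. Q y = 0"
proof -
  interpret A: subgroup A D by (rule A)
  have fin: "finite A"
    using A.subset finite_carrier by (rule finite_subset)
  have N: "card (generate D {x}) \<le> 2" "finite (generate D {x})"
    using card_generate_le [of x 2] x A A.subset generate_incl [of "{x}"] finite_carrier
    by (auto intro: finite_subset)
  interpret N: subgroup "generate D {x}" D
    using x by (intro generate_is_subgroup) auto
  \<comment> \<open>The cross term 2(y, z) = (2y, z) vanishes because y has exponent 2.\<close>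
  have add: "int_scale 2 (Q (y \<otimes> z)) = int_scale 2 (Q y) + int_scale 2 (Q z)"
    if "y \<in> A" "z \<in> A" for y z
    using that A(2) bform_nat_pow_left [of y z 2]
    by (simp add: Q_mult int_scale_add_right)
  have tors: "int_scale (int 2) (int_scale 2 (Q y)) = 0" if "y \<in> A" for y
    using that A(2) double_exponent_scale_Q [of y 2] by (simp add: int_scale_int_scale)
  define K where "K = {y \<in> A. int_scale 2 (Q y) = 0}"
  have K: "subgroup K D"
    unfolding K_def by (rule subgroup_kernel [OF A(1) add])
  have "card A \<le> 2 * card K"
    unfolding K_def by (rule card_le_card_kernel [OF A(1) add _ tors]) auto
  then have cK: "card K \<ge> 16"
    using card by simp
  have "\<not> K \<subseteq> generate D {x}"
    using cK N card_mono [of "generate D {x}" K] by auto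
  then obtain x1 where x1: "x1 \<in> K" "x1 \<notin> generate D {x}" by blast
  then have x1c: "x1 \<in> carrier D" by (auto simp: K_def)
  define K1 where "K1 = {y \<in> K. bform D Q x1 y = 0}"
  have "card K \<le> 2 * card K1"
    unfolding K1_def using x1c A(2) by (intro card_le_card_orthogonal K) (auto simp: K_def)
  then have cK1: "card K1 \<ge> 8"
    using cK by simp
  \<comment> \<open>Avoiding \<open>N'\<close> keeps both x2 and x1 + x2 (additively) outside the
    cyclic group of x. It has at most 4 elements, \<open>K1\<close> at least 8.\<close>
  define N' where "N' = generate D {x} \<union> (\<lambda>n. n \<otimes> inv x1) ` generate D {x}"
  have "card N' \<le> card (generate D {x}) + card ((\<lambda>n. n \<otimes> inv x1) ` generate D {x})"
    unfolding N'_def by (rule card_Un_le)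
  also have "\<dots> \<le> 4"
    using N card_image_le [of "generate D {x}" "\<lambda>n. n \<otimes> inv x1"] by simp
  finally have "card N' \<le> 4" .
  moreover have "finite N'" using N by (simp add: N'_def)
  ultimately have "\<not> K1 \<subseteq> N'"
    using cK1 card_mono [of N' K1] by auto
  then obtain x2 where x2: "x2 \<in> K1" "x2 \<notin> N'" by blast
  then have x2': "x2 \<in> K" "bform D Q x1 x2 = 0" "x2 \<in> carrier D"
    by (auto simp: K1_def K_def)
  \<comment> \<open>On K the form takes only the values 0 and 1/2, so two orthogonal elements with
    nonzero values add up to an isotropic one.\<close>
  have two: "Q y = rmi (1 / 2)" if "y \<in> K" "Q y \<noteq> 0" for y
  proof -
    have "int_scale (int 2) (Q y) = 0" using that by (simp add: K_def)
    then obtain k :: int where k: "k \<in> {0..<int 2}" "Q y = rmi (of_int k / of_nat 2)"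
      using int_scale_eq_0_imp by (metis zero_less_numeral)
    then have "k = 0 \<or> k = 1" by auto
    then show ?thesis
      using k that by (auto simp: rmi_eq_0_iff)
  qed
  show ?thesis
  proof (cases "Q x1 = 0 \<or> Q x2 = 0")
    case True
    then show ?thesis
      using x1 x2 x2' by (auto simp: K_def N'_def)
  next
    case False
    then have "Q x1 = rmi (1 / 2)" "Q x2 = rmi (1 / 2)"
      using two x1 x2' by blast+
    then have "Q (x1 \<otimes> x2) = rmi (1 / 2) + rmi (1 / 2)"
      using x2' by (simp add: Q_mult)
    also have "\<dots> = 0"
      by (simp add: rmi_add rmi_eq_0_iff)
    finally have "Q (x1 \<otimes> x2) = 0" .
    moreover have "x1 \<otimes> x2 \<notin> generate D {x}"
    proof
      assume *: "x1 \<otimes> x2 \<in> generate D {x}"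
      have "x2 = (x1 \<otimes> x2) \<otimes> inv x1"
        using x1c x2'(3) m_comm [of x1 x2] by (simp add: m_assoc)
      with * have "x2 \<in> N'" unfolding N'_def by blast
      with x2 show False by blast
    qed
    moreover have "x1 \<otimes> x2 \<in> A"
      using x1 x2' by (auto simp: K_def)
    ultimately show ?thesis by blast
  qed
qed

lemma isotropic_element:
  assumes "prime p" and "subgroup A D" "\<And>y. y \<in> A \<Longrightarrow> y [^] p = \<one>"
    and "x \<in> A" "\<And>y. y \<in> A \<Longrightarrow> bform D Q x y = 0"
    and "card A \<ge> p ^ 5"
  shows "\<exists>y\<in>A - generate D {x}. Q y = 0"
proof (cases "odd p")
  case True
  then show ?thesis using assms isotropic_element_odd by blast
next
  case False
  then have "p = 2" using assms(1) prime_odd_nat prime_ge_2_nat by (metis le_neq_implies_less)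
  then show ?thesis using assms isotropic_element_two by blast
qed

text \<open>The exponent 7 is spent as follows: one factor p for orthogonality to g, one for
  orthogonality to a first isotropic element x, and the remaining p^5 yields a second isotropic
  element y outside the cyclic group of x. Then I is generated by x and y.\<close>

lemma isotropic_subgroup_in_large_elementary:
  assumes p: "prime p" and A: "subgroup A D" "\<And>y. y \<in> A \<Longrightarrow> y [^] p = \<one>"
    and g: "g \<in> carrier D" and card: "card A \<ge> p ^ 7"
  shows "\<exists>I. isotropic D Q I \<and> g \<in> perp D Q I \<and> (\<forall>u\<in>I. u [^] p = \<one>) \<and> card I > p"
proof -
  have p1: "p > 1" using p by (rule prime_gt_1_nat)
  define B where "B = {y \<in> A. bform D Q g y = 0}"
  have B: "subgroup B D"
    unfolding B_def using A(1) g by (rule subgroup_orthogonal)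
  interpret B: subgroup B D by (rule B)
  have cd: "p ^ 7 = p * p ^ 6" "p ^ 6 = p * p ^ 5"
    by (simp_all add: eval_nat_numeral)
  have "card A \<le> p * card B"
    unfolding B_def using A g p1 by (intro card_le_card_orthogonal) auto
  then have "p * p ^ 6 \<le> p * card B"
    using card cd by linarith
  then have cB: "p ^ 6 \<le> card B"
    using p1 by simp
  have Bexp: "y [^] p = \<one>" if "y \<in> B" for y
    using that A by (simp add: B_def)
  have "p ^ 5 \<le> p ^ 6"
    using p1 by (simp add: power_increasing)
  \<comment> \<open>With the neutral element in the place of x, \<open>isotropic_element\<close>
    just produces a nontrivial isotropic element.\<close>
  then have "\<exists>x\<in>B - generate D {\<one>}. Q x = 0"
    using cB by (intro isotropic_element [OF p B]) (auto simp: Bexp)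
  moreover have "\<one> \<in> generate D {\<one>}"
    by (rule generate.one)
  ultimately obtain x where x: "x \<in> B" "x \<noteq> \<one>" "Q x = 0"
    by blast
  then have xc: "x \<in> carrier D" by simp
  define C where "C = {y \<in> B. bform D Q x y = 0}"
  have C: "subgroup C D"
    unfolding C_def using B xc by (rule subgroup_orthogonal)
  have "card B \<le> p * card C"
    unfolding C_def using B xc p1 Bexp by (intro card_le_card_orthogonal) auto
  then have "p * p ^ 5 \<le> p * card C"
    using cB cd by linarith
  then have cC: "p ^ 5 \<le> card C"
    using p1 by simp
  have "x \<in> C"
    using x xc by (simp add: C_def bform_self)
  then have "\<exists>y\<in>C - generate D {x}. Q y = 0"
    using cC by (intro isotropic_element [OF p C]) (auto simp: Bexp C_def)
  then obtain y where y: "y \<in> C" "y \<notin> generate D {x}" "Q y = 0" by blast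
  then have yB: "y \<in> B" "bform D Q x y = 0" and yc: "y \<in> carrier D"
    by (auto simp: C_def)
  define I where "I = {x [^] (m :: nat) \<otimes> y [^] (n :: nat) | m n. True}"
  have powB: "z [^] k \<in> B" if "z \<in> B" for z and k :: nat
    using that by (induction k) auto
  have IB: "I \<subseteq> B"
    using powB [OF x(1)] powB [OF yB(1)] by (auto simp: I_def)
  have inI: "x [^] m \<otimes> y [^] n \<in> I" for m n :: nat
    unfolding I_def by blast
  have "subgroup I D"
  proof (rule subgroupI)
    show "I \<subseteq> carrier D" using IB by auto
    show "I \<noteq> {}" using inI by blast
    show mult: "a \<otimes> b \<in> I" if "a \<in> I" "b \<in> I" for a b
    proof -
      obtain m n m' n' :: nat where ab: "a = x [^] m \<otimes> y [^] n" "b = x [^] m' \<otimes> y [^] n'"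
        using \<open>a \<in> I\<close> \<open>b \<in> I\<close> unfolding I_def by blast
      have "a \<otimes> b = x [^] (m + m') \<otimes> y [^] (n + n')"
        using xc yc by (simp add: ab nat_pow_mult [symmetric] m_ac)
      then show ?thesis using inI by simp
    qed
    show "inv a \<in> I" if "a \<in> I" for a
    proof -
      have ac: "a \<in> carrier D" "a [^] p = \<one>" using \<open>a \<in> I\<close> IB Bexp by auto
      have "a \<otimes> a [^] (p - 1) = \<one>"
        using ac p1 by (metis Suc_diff_1 less_trans nat_pow_Suc2 zero_less_one)
      \<comment> \<open>Exponent p turns inverses into natural powers, so closure under products is
        enough.\<close>
      then have "inv a = a [^] (p - 1)"
        using ac by (metis inv_equality m_comm nat_pow_closed)
      moreover have "a [^] k \<in> I" for k :: nat
        using \<open>a \<in> I\<close> inI [of 0 0] by (induction k) (auto simp: mult)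
      ultimately show ?thesis by simp
    qed
  qed
  moreover have "Q z = 0" if "z \<in> I" for z
    using that xc yc x y yB
    by (auto simp: I_def Q_mult Q_nat_pow bform_nat_pow_left bform_nat_pow_right)
  ultimately have iso: "isotropic D Q I"
    by (simp add: isotropic_def)
  have gI: "g \<in> perp D Q I"
    using g IB by (auto simp: perp_def B_def)
  have "generate D {x} \<subseteq> I"
    using inI [of _ 0] xc by (auto simp: generate_singleton_nat)
  moreover have "y \<in> I"
    using inI [of 0 1] yc by simp
  \<comment> \<open>This set has p + 1 elements, which gives \<open>card I > p\<close>.\<close>
  ultimately have "insert y (generate D {x}) \<subseteq> I" by blast
  moreover have finI: "finite I"
    using IB finite_carrier by (meson B.subset finite_subset)
  ultimately have "card (insert y (generate D {x})) \<le> card I"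
    by (intro card_mono)
  moreover have "finite (generate D {x})"
    using finI \<open>generate D {x} \<subseteq> I\<close> by (rule rev_finite_subset)
  moreover have "ord x = p"
  proof -
    have "ord x dvd p" using Bexp [of x] x xc pow_eq_id by simp
    moreover have "ord x \<noteq> 1" using x xc by (metis ord_eq_1)
    ultimately show ?thesis using p by (metis prime_nat_iff)
  qed
  then have "card (generate D {x}) = p"
    using generate_pow_card [OF xc] by simp
  ultimately have "card I > p"
    using y by simp
  then show ?thesis
    using iso gI IB Bexp by blast
qed

end

section \<open>Elementary subgroups from a Jordan splitting\<close>

lemma length_filter_disj:
  assumes "\<And>x. x \<in> set xs \<Longrightarrow> \<not> (P x \<and> R x)"
  shows "length (filter (\<lambda>x. P x \<or> R x) xs) = length (filter P xs) + length (filter R xs)"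
  using assms by (induction xs) auto

context discriminant_form
begin

text \<open>In additive notation this is \<open>p\<^bsup>j-1\<^esup> D[p\<^bsup>j\<^esup>]\<close>.\<close>

definition power_torsion :: "nat \<Rightarrow> nat \<Rightarrow> 'a set"
  where "power_torsion p j = {x [^] (p ^ (j - 1)) | x. x \<in> carrier D \<and> x [^] (p ^ j) = \<one>}"

lemma power_torsionI:
  "x \<in> carrier D \<Longrightarrow> x [^] (p ^ j) = \<one> \<Longrightarrow> x [^] (p ^ (j - 1)) \<in> power_torsion p j"
  unfolding power_torsion_def by blast

lemma power_torsion_subgroup: "subgroup (power_torsion p j) D"
proof (rule subgroupI)
  show "power_torsion p j \<subseteq> carrier D"
    by (auto simp: power_torsion_def)
  show "power_torsion p j \<noteq> {}"
    using power_torsionI [of \<one> p j] by auto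
  show "inv a \<in> power_torsion p j" if "a \<in> power_torsion p j" for a
  proof -
    obtain x where x: "x \<in> carrier D" "x [^] (p ^ j) = \<one>" "a = x [^] (p ^ (j - 1))"
      using \<open>a \<in> power_torsion p j\<close> unfolding power_torsion_def by blast
    then have "inv a = inv x [^] (p ^ (j - 1))" "inv x [^] (p ^ j) = \<one>"
      by (simp_all add: nat_pow_inv)
    with x power_torsionI show ?thesis by simp
  qed
  show "a \<otimes> b \<in> power_torsion p j" if ab: "a \<in> power_torsion p j" "b \<in> power_torsion p j" for a b
  proof -
    obtain x y where x: "x \<in> carrier D" "x [^] (p ^ j) = \<one>" "a = x [^] (p ^ (j - 1))"
      and y: "y \<in> carrier D" "y [^] (p ^ j) = \<one>" "b = y [^] (p ^ (j - 1))"
      using ab unfolding power_torsion_def by blast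
    then have "a \<otimes> b = (x \<otimes> y) [^] (p ^ (j - 1))" "(x \<otimes> y) [^] (p ^ j) = \<one>"
      by (simp_all add: nat_pow_distrib)
    with x y power_torsionI show ?thesis by simp
  qed
qed

lemma power_torsion_exponent:
  assumes "j \<ge> 1" "a \<in> power_torsion p j"
  shows "a [^] p = \<one>"
proof -
  obtain x where x: "x \<in> carrier D" "x [^] (p ^ j) = \<one>" "a = x [^] (p ^ (j - 1))"
    using assms(2) unfolding power_torsion_def by blast
  have "p ^ (j - 1) * p = p ^ j"
    using assms(1) by (metis Suc_diff_1 less_eq_Suc_le One_nat_def power_Suc2)
  then show ?thesis
    using x by (simp add: nat_pow_pow)
qed

text \<open>For a = p^(j-1) x one has Q(a) = p^(2j-2) Q(x), while Q(x) is killed by p^j for odd p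
  and by 2^(j+1) for p = 2. The bounds on j say 2j - 2 \<ge> j and 2j - 2 \<ge> j + 1
  respectively.\<close>

lemma power_torsion_isotropic:
  assumes "odd p \<and> j \<ge> 2 \<or> p = 2 \<and> j \<ge> 3" "a \<in> power_torsion p j"
  shows "Q a = 0"
proof -
  obtain x where x: "x \<in> carrier D" "x [^] (p ^ j) = \<one>" "a = x [^] (p ^ (j - 1))"
    using assms(2) unfolding power_torsion_def by blast
  have "(int (p ^ (j - 1)))\<^sup>2 = int p ^ (2 * (j - 1))"
    by (simp add: power_mult [symmetric] mult.commute)
  then have Qa: "Q a = int_scale (int p ^ (2 * (j - 1))) (Q x)"
    using x by (simp add: Q_nat_pow)
  from assms(1) show ?thesis
  proof
    assume p: "odd p \<and> j \<ge> 2"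
    then have "int_scale (int (p ^ j)) (Q x) = 0"
      using x by (intro odd_exponent_scale_Q) auto
    moreover have "int (p ^ j) dvd int p ^ (2 * (j - 1))"
      unfolding of_nat_power using p by (intro le_imp_power_dvd) auto
    ultimately show ?thesis
      unfolding Qa by (rule int_scale_dvd)
  next
    assume p: "p = 2 \<and> j \<ge> 3"
    have "int_scale (2 * int (p ^ j)) (Q x) = 0"
      using x by (intro double_exponent_scale_Q) auto
    moreover have "2 ^ Suc j dvd (2 :: int) ^ (2 * (j - 1))"
      using p by (intro le_imp_power_dvd) auto
    then have "2 * int (p ^ j) dvd int p ^ (2 * (j - 1))"
      using p by simp
    ultimately show ?thesis
      unfolding Qa by (rule int_scale_dvd)
  qed
qed

lemma finprod_in_subgroup:
  assumes "subgroup A D" "finite S" "\<And>i. i \<in> S \<Longrightarrow> h i \<in> A"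
  shows "finprod D h S \<in> A"
  using assms(2,3)
proof (induction S rule: finite_induct)
  case empty
  then show ?case using assms(1) by (simp add: subgroup.one_closed)
next
  case (insert i S)
  then have "h \<in> S \<rightarrow> carrier D" "h i \<in> carrier D"
    using assms(1) subgroup.mem_carrier by fastforce+
  with insert show ?case
    using assms(1) by (simp add: subgroup.m_closed)
qed

text \<open>Each component with index in J supplies a generator of order p^j, whose p^(j-1)-th power
  has order p. Uniqueness of the Jordan decomposition makes all products of powers of these elements
  distinct. An even 2-adic component contributes one of its two generators.\<close>

lemma card_power_torsion_ge:
  assumes split: "jordan_splitting D Q cs" and p: "prime p" and j: "j \<ge> 1"
    and J: "J \<subseteq> {..<length cs}"
    and gens: "\<And>i. i \<in> J \<Longrightarrow> \<exists>g \<in> component_gens (cs ! i). g \<in> carrier D \<and> ord g = p ^ j"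
  shows "p ^ card J \<le> card (power_torsion p j)"
proof -
  have p0: "p > 0" using p by (rule prime_gt_0_nat)
  have pj: "p ^ (j - 1) * p = p ^ j"
    using j by (metis Suc_diff_1 less_eq_Suc_le One_nat_def power_Suc2)
  obtain g where g: "\<And>i. i \<in> J \<Longrightarrow> g i \<in> component_gens (cs ! i)"
    "\<And>i. i \<in> J \<Longrightarrow> g i \<in> carrier D" "\<And>i. i \<in> J \<Longrightarrow> ord (g i) = p ^ j"
    using gens by metis
  define n where "n = length cs"
  \<comment> \<open>The components of the element belonging to the exponent vector f; outside J they
    are neutral.\<close>
  define h where "h f = (\<lambda>i\<in>{..<n}. if i \<in> J then g i [^] (p ^ (j - 1) * f i) else \<one>)"
    for f :: "nat \<Rightarrow> nat"
  define P where "P = (\<Pi>\<^sub>E i\<in>{..<n}. component_group D (cs ! i))"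
  have inj: "inj_on (\<lambda>f. finprod D f {..<n}) P"
    using split by (simp add: jordan_splitting_def bij_betw_def n_def P_def)
  have hP: "h f \<in> P" for f
  proof -
    have "g i [^] k \<in> component_group D (cs ! i)" if "i \<in> J" for i and k :: nat
      using g(1) [OF that] unfolding component_group_def
      by (induction k) (auto intro: generate.intros)
    then show ?thesis
      by (auto simp: h_def P_def component_group_def intro: generate.one)
  qed
  have "inj_on h (J \<rightarrow>\<^sub>E {..<p})"
  proof (rule inj_onI)
    fix f f' assume f: "f \<in> J \<rightarrow>\<^sub>E {..<p}" "f' \<in> J \<rightarrow>\<^sub>E {..<p}" and eq: "h f = h f'"
    show "f = f'"
    proof (rule PiE_ext [OF f])
      fix i assume i: "i \<in> J"
      with J have "i < n" by (auto simp: n_def)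
      with i fun_cong [OF eq, of i] have "g i [^] (p ^ (j - 1) * f i) = g i [^] (p ^ (j - 1) * f' i)"
        by (simp add: h_def)
      \<comment> \<open>Equal powers of an element of order p^j have exponents congruent modulo p^j;
        cancelling p^(j-1) leaves a congruence modulo p.\<close>
      then have "int (p ^ j) dvd int (p ^ (j - 1) * f i) - int (p ^ (j - 1) * f' i)"
        using g(2,3) [OF i] int_pow_eq [of "g i" "int (p ^ (j - 1) * f' i)" "int (p ^ (j - 1) * f i)"]
        by (simp only: int_pow_int) (metis dvd_diff_commute)
      then have "int (p ^ (j - 1)) * int p dvd int (p ^ (j - 1)) * (int (f i) - int (f' i))"
        unfolding pj [symmetric] by (simp add: algebra_simps)
      then have "int p dvd int (f i) - int (f' i)"
        using p0 by simp
      then have "int (f i) mod int p = int (f' i) mod int p"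
        by (simp add: mod_eq_dvd_iff)
      moreover have "f i < p" "f' i < p"
        using f i by auto
      ultimately show "f i = f' i" by simp
    qed
  qed
  moreover have "inj_on (\<lambda>f. finprod D f {..<n}) (h ` (J \<rightarrow>\<^sub>E {..<p}))"
    using inj hP by (auto intro: inj_on_subset)
  ultimately have inj': "inj_on ((\<lambda>f. finprod D f {..<n}) \<circ> h) (J \<rightarrow>\<^sub>E {..<p})"
    by (rule comp_inj_on)
  have "((\<lambda>f. finprod D f {..<n}) \<circ> h) ` (J \<rightarrow>\<^sub>E {..<p}) \<subseteq> power_torsion p j"
  proof -
    have "h f i \<in> power_torsion p j" if "i < n" for f i
    proof (cases "i \<in> J")
      case True
      have "(g i [^] f i) [^] (p ^ (j - 1)) = h f i"
        using that True g(2) by (simp add: h_def nat_pow_pow mult.commute)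
      moreover have "(g i [^] f i) [^] (p ^ j) = (g i [^] (p ^ j)) [^] f i"
        using True g(2) by (simp add: nat_pow_pow mult.commute)
      then have "(g i [^] f i) [^] (p ^ j) = \<one>"
        using True g(2,3) by (metis nat_pow_one pow_ord_eq_1)
      ultimately show ?thesis
        using power_torsionI [of "g i [^] f i" p j] True g(2) by simp
    next
      case False
      then show ?thesis
        using that subgroup.one_closed [OF power_torsion_subgroup] by (simp add: h_def)
    qed
    then show ?thesis
      by (auto intro!: finprod_in_subgroup power_torsion_subgroup)
  qed
  moreover have "finite (power_torsion p j)"
    using power_torsion_subgroup finite_carrier by (meson finite_subset subgroup.subset)
  ultimately have "card (J \<rightarrow>\<^sub>E {..<p}) \<le> card (power_torsion p j)"
    using inj' by (intro card_inj_on_le)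
  moreover have "finite J" using J finite_subset by blast
  ultimately show ?thesis
    by (simp add: card_PiE)
qed

text \<open>Bridges the ranks, which are lengths of filtered lists, and the index sets of
  \<open>card_power_torsion_ge\<close>.\<close>

lemma card_power_torsion_ge_rank:
  assumes split: "jordan_splitting D Q cs" and p: "prime p" and j: "j \<ge> 1"
    and gens: "\<And>c. c \<in> set cs \<Longrightarrow> P c \<Longrightarrow>
      \<exists>g \<in> component_gens c. g \<in> carrier D \<and> ord g = p ^ j"
    and r: "r \<le> length (filter P cs)"
  shows "p ^ r \<le> card (power_torsion p j)"
proof -
  have "p ^ r \<le> p ^ length (filter P cs)"
    using r p by (intro power_increasing) (auto dest: prime_gt_0_nat)
  also have "\<dots> = p ^ card {i. i < length cs \<and> P (cs ! i)}"
    by (simp add: length_filter_conv_card)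
  also have "\<dots> \<le> card (power_torsion p j)"
    using gens by (intro card_power_torsion_ge [OF split p j]) auto
  finally show ?thesis .
qed

text \<open>For odd p with j > 1 and for p = 2 with j \<ge> 3, \<open>power_torsion p j\<close> is
  itself isotropic, and p^3 elements leave p^2 orthogonal to g. In the other cases it has at least
  p^7 elements, and \<open>isotropic_subgroup_in_large_elementary\<close> applies. The prime is
  chosen before g; only I depends on g.\<close>

lemma exists_isotropic_subgroup_of_large_rank:
  assumes split: "jordan_splitting D Q cs"
    and ranks: "(\<exists>p. prime p \<and> odd p \<and> odd_prime_rank cs p 1 \<ge> 7)
      \<or> (\<exists>p j. prime p \<and> odd p \<and> j > 1 \<and> odd_prime_rank cs p j \<ge> 4)
      \<or> (\<exists>j \<in> {1, 2}. even_two_rank cs j + odd_two_rank cs j \<ge> 9)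
      \<or> (\<exists>j \<ge> 3. even_two_rank cs j + odd_two_rank cs j \<ge> 5)"
  obtains p where "prime p" "\<And>g. g \<in> carrier D \<Longrightarrow>
    \<exists>I. isotropic D Q I \<and> g \<in> perp D Q I \<and> (\<forall>u\<in>I. u [^] p = \<one>) \<and> card I > p"
proof -
  have odd_card: "p ^ r \<le> card (power_torsion p j)"
    if "prime p" "j \<ge> 1" "r \<le> odd_prime_rank cs p j" for p j r
    using that(3) unfolding odd_prime_rank_def
    by (rule card_power_torsion_ge_rank [OF split that(1,2), rotated])
      (use split in \<open>auto simp: jordan_splitting_def\<close>)
  have two_card: "2 ^ r \<le> card (power_torsion 2 j)"
    if "j \<ge> 1" "r \<le> even_two_rank cs j + odd_two_rank cs j" for j r
  proof (rule card_power_torsion_ge_rank [OF split two_is_prime_nat that(1)])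
    show "r \<le> length (filter (\<lambda>c. (\<exists>\<gamma> \<delta>. c = Even_Two j \<gamma> \<delta>) \<or> (\<exists>\<gamma>. c = Odd_Two j \<gamma>)) cs)"
      using that(2) unfolding even_two_rank_def odd_two_rank_def
      by (subst length_filter_disj) auto
  qed (use split in \<open>auto simp: jordan_splitting_def\<close>)
  have iso: "\<exists>I. isotropic D Q I \<and> g \<in> perp D Q I \<and> (\<forall>u\<in>I. u [^] p = \<one>) \<and> card I > p"
    if p: "prime p" and pj: "odd p \<and> j \<ge> 2 \<or> p = 2 \<and> j \<ge> 3"
      and card: "p ^ 3 \<le> card (power_torsion p j)" and g: "g \<in> carrier D" for p j g
  proof -
    have p1: "p > 1" using p by (rule prime_gt_1_nat)
    have j: "j \<ge> 1" using pj by auto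
    define I where "I = {y \<in> power_torsion p j. bform D Q g y = 0}"
    have "subgroup I D"
      unfolding I_def using power_torsion_subgroup g by (rule subgroup_orthogonal)
    then have "isotropic D Q I"
      using power_torsion_isotropic [OF pj] by (auto simp: isotropic_def I_def)
    moreover have "card (power_torsion p j) \<le> p * card I"
      unfolding I_def using power_torsion_subgroup g power_torsion_exponent [OF j] p1
      by (intro card_le_card_orthogonal) auto
    then have "p * p ^ 2 \<le> p * card I"
      using card unfolding power3_eq_cube power2_eq_square mult.assoc by (rule order_trans [rotated])
    then have "p ^ 2 \<le> card I"
      using p1 by simp
    moreover have "p < p ^ 2"
      using p1 by (simp add: power2_eq_square)
    moreover have "g \<in> perp D Q I"
      using g by (auto simp: perp_def I_def)
    moreover have "\<forall>u\<in>I. u [^] p = \<one>"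
      using power_torsion_exponent [OF j] by (auto simp: I_def)
    ultimately show ?thesis
      by (intro exI [of _ I]) auto
  qed
  have elem: "\<exists>I. isotropic D Q I \<and> g \<in> perp D Q I \<and> (\<forall>u\<in>I. u [^] p = \<one>) \<and> card I > p"
    if "prime p" "j \<ge> 1" "p ^ 7 \<le> card (power_torsion p j)" "g \<in> carrier D" for p j g
    using that power_torsion_exponent
    by (intro isotropic_subgroup_in_large_elementary [OF _ power_torsion_subgroup]) auto
  from ranks consider
      p where "prime p" "odd p" "odd_prime_rank cs p 1 \<ge> 7"
    | p j where "prime p" "odd p" "j > 1" "odd_prime_rank cs p j \<ge> 4"
    | j where "j \<in> {1, 2}" "even_two_rank cs j + odd_two_rank cs j \<ge> 9"
    | j where "j \<ge> 3" "even_two_rank cs j + odd_two_rank cs j \<ge> 5"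
    by blast
  then show thesis
  proof cases
    case (1 p)
    then show thesis
      by (intro that [of p] elem [of p 1] odd_card) auto
  next
    case (2 p j)
    then show thesis
      by (intro that [of p] iso [of p j] odd_card) auto
  next
    case (3 j)
    then show thesis
      by (intro that [of 2] elem [of 2 j] two_card) auto
  next
    case (4 j)
    then show thesis
      by (intro that [of 2] iso [of 2 j] two_card) auto
  qed
qed

section \<open>Vanishing of a coefficient from its sums over isotropic cosets\<close>

text \<open>Summing the hypothesis over the cyclic groups generated by the nontrivial elements of \<open>I\<close>
  counts \<open>v g\<close> exactly \<open>card I - 1\<close> times and every other value on the coset \<open>I g\<close> exactly
  \<open>p - 1\<close> times.\<close>

lemma vanishing_from_isotropic_sums:
  fixes v :: "'a \<Rightarrow> complex"
  assumes p: "prime p" and I: "isotropic D Q I" "g \<in> perp D Q I" "\<And>u. u \<in> I \<Longrightarrow> u [^] p = \<one>"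
    and card: "card I > p"
    and sums: "\<And>H. isotropic D Q H \<Longrightarrow> H \<noteq> {\<one>} \<Longrightarrow> g \<in> perp D Q H \<Longrightarrow> (\<Sum>h\<in>H. v (h \<otimes> g)) = 0"
  shows "v g = 0"
proof -
  have sub: "subgroup I D" using I by (simp add: isotropic_def)
  interpret I: subgroup I D by (rule sub)
  have p1: "p > 1" using p by (rule prime_gt_1_nat)
  have g: "g \<in> carrier D" using I by (simp add: perp_def)
  have fin: "finite I" using I.subset finite_carrier by (rule finite_subset)
  \<comment> \<open>Every nontrivial u in I has order p, so its cyclic group is listed without
    repetition by the powers with exponents below p.\<close>
  have line: "(\<Sum>s<p. v (u [^] s \<otimes> g)) = 0" if u: "u \<in> I - {\<one>}" for u
  proof -
    have uc: "u \<in> carrier D" "u [^] p = \<one>" using u I by auto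
    have "ord u dvd p" using uc pow_eq_id by simp
    moreover have "ord u \<noteq> 1" using u uc by (metis DiffD2 ord_eq_1 singletonI)
    ultimately have ord: "ord u = p" using p by (metis prime_nat_iff)
    have range: "{0..ord u - 1} = {..<p}"
      using p1 by (auto simp: ord)
    have "generate D {u} = (\<lambda>s. u [^] s) ` {..<p}"
      using ord_elems [OF finite_carrier uc(1)] uc(1) range
      by (auto simp: generate_singleton_nat)
    moreover have "inj_on (\<lambda>s. u [^] s) {..<p}"
      using ord_inj [OF uc(1)] unfolding range .
    ultimately have "(\<Sum>h\<in>generate D {u}. v (h \<otimes> g)) = (\<Sum>s<p. v (u [^] s \<otimes> g))"
      by (simp add: sum.reindex)
    moreover have gI: "generate D {u} \<subseteq> I"
      using u sub by (intro generate_subgroup_incl) auto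
    have "isotropic D Q (generate D {u})"
      using I uc gI by (auto simp: isotropic_def intro!: generate_is_subgroup)
    moreover have "generate D {u} \<noteq> {\<one>}"
      using u generate.incl [of u "{u}" D] by auto
    moreover have "g \<in> perp D Q (generate D {u})"
      using I gI by (auto simp: perp_def)
    ultimately show ?thesis using sums by metis
  qed
  have plane: "(\<Sum>h\<in>I. v (h \<otimes> g)) = 0"
  proof (rule sums [OF I(1) _ I(2)])
    show "I \<noteq> {\<one>}" using card p1 by auto
  qed
  \<comment> \<open>Raising to a power s prime to p permutes the nontrivial elements of I; the
    inverse map raises to a power t with s t congruent to 1 modulo p. The sum is then the sum over
    all of I, which is 0, without the term \<open>v g\<close>.\<close>
  have perm: "(\<Sum>u\<in>I - {\<one>}. v (u [^] s \<otimes> g)) = - v g" if s: "s \<in> {1..<p}" for s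
  proof -
    have "\<not> p dvd s"
      using s by (auto dest: dvd_imp_le)
    then have "coprime s p"
      using prime_imp_coprime [OF p, of s] coprime_commute by blast
    then obtain t where t: "[s * t = 1] (mod p)"
      using cong_solve_coprime_nat by auto
    have inverse_pow: "(u [^] s) [^] t = u" if u: "u \<in> I" for u
    proof -
      have "(s * t) mod p = 1"
        using t p1 by (simp add: cong_def)
      then have "s * t = p * (s * t div p) + 1"
        by (metis mult_div_mod_eq)
      then have "u [^] (s * t) = u [^] (p * (s * t div p) + 1)"
        by simp
      also have "\<dots> = (u [^] p) [^] (s * t div p) \<otimes> u"
        using u by (simp add: nat_pow_pow)
      finally show ?thesis
        using u I(3) by (simp add: nat_pow_pow)
    qed
    have powI: "u [^] k \<in> I" if "u \<in> I" for u and k :: nat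
      using that by (induction k) auto
    have inj: "inj_on (\<lambda>u. u [^] s) (I - {\<one>})"
      by (rule inj_on_inverseI [where g = "\<lambda>u. u [^] t"]) (simp add: inverse_pow)
    have "u [^] s \<noteq> \<one>" if "u \<in> I - {\<one>}" for u
      using inverse_pow [of u] that by auto
    then have "(\<lambda>u. u [^] s) ` (I - {\<one>}) \<subseteq> I - {\<one>}"
      using powI by auto
    then have "(\<lambda>u. u [^] s) ` (I - {\<one>}) = I - {\<one>}"
      using inj fin by (intro endo_inj_surj) auto
    then have "(\<Sum>u\<in>I - {\<one>}. v (u [^] s \<otimes> g)) = (\<Sum>u\<in>I - {\<one>}. v (u \<otimes> g))"
      using inj sum.reindex [of "\<lambda>u. u [^] s" "I - {\<one>}" "\<lambda>u. v (u \<otimes> g)"] by simp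
    also have "\<dots> = - v g"
      using plane fin g by (simp add: sum_diff1)
    finally show ?thesis .
  qed
  have "0 = (\<Sum>u\<in>I - {\<one>}. \<Sum>s<p. v (u [^] s \<otimes> g))"
    using line by simp
  also have "\<dots> = (\<Sum>s<p. \<Sum>u\<in>I - {\<one>}. v (u [^] s \<otimes> g))"
    by (rule sum.swap)
  \<comment> \<open>After the exchange of sums, s = 0 contributes \<open>card I - 1\<close> copies
    of \<open>v g\<close>, and each of the other p - 1 exponents contributes
    \<open>- v g\<close>.\<close>
  also have "\<dots> = (\<Sum>u\<in>I - {\<one>}. v (u [^] (0 :: nat) \<otimes> g)) + (\<Sum>s\<in>{1..<p}. - v g)"
  proof -
    have "{..<p} = insert 0 {1..<p}" using p1 by auto
    then show ?thesis using perm by simp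
  qed
  also have "\<dots> = of_nat (card I - 1) * v g - of_nat (p - 1) * v g"
    using g fin by simp
  also have "\<dots> = ((of_nat (card I) - 1) - (of_nat p - 1)) * v g"
  proof -
    have "1 \<le> card I" "1 \<le> p" using card p1 by auto
    then show ?thesis
      by (simp only: left_diff_distrib of_nat_diff of_nat_1)
  qed
  also have "\<dots> = (of_nat (card I) - of_nat p) * v g"
    by simp
  finally show ?thesis
    using card by auto
qed

end

section \<open>Linear maps on group algebras\<close>

text \<open>Linearity is asked for on the group algebra only, since
  \<open>weil_representation\<close> says nothing about functions outside it.\<close>

definition algebra_linear :: "'a monoid \<Rightarrow> (('a \<Rightarrow> complex) \<Rightarrow> 'b \<Rightarrow> complex) \<Rightarrow> bool"
  where "algebra_linear D L \<longleftrightarrow>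
    (\<forall>v \<in> group_algebra D. \<forall>w \<in> group_algebra D. \<forall>a b.
      L (\<lambda>\<gamma>. a * v \<gamma> + b * w \<gamma>) = (\<lambda>\<gamma>. a * L v \<gamma> + b * L w \<gamma>))"

lemma algebra_linearD:
  "\<lbrakk>algebra_linear D L; v \<in> group_algebra D; w \<in> group_algebra D\<rbrakk>
    \<Longrightarrow> L (\<lambda>\<gamma>. a * v \<gamma> + b * w \<gamma>) = (\<lambda>\<gamma>. a * L v \<gamma> + b * L w \<gamma>)"
  by (simp add: algebra_linear_def)

lemma group_algebra_zero [simp]: "(\<lambda>_. 0) \<in> group_algebra D"
  and group_algebra_lincomb:
    "v \<in> group_algebra D \<Longrightarrow> w \<in> group_algebra D \<Longrightarrow> (\<lambda>\<gamma>. a * v \<gamma> + b * w \<gamma>) \<in> group_algebra D"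
  and group_algebra_scale: "v \<in> group_algebra D \<Longrightarrow> (\<lambda>\<gamma>. a * v \<gamma>) \<in> group_algebra D"
  and group_algebra_sum:
    "(\<And>i. i \<in> S \<Longrightarrow> f i \<in> group_algebra D) \<Longrightarrow> (\<lambda>\<gamma>. \<Sum>i\<in>S. f i \<gamma>) \<in> group_algebra D"
  and basis_vec_in_group_algebra: "\<gamma> \<in> carrier D \<Longrightarrow> basis_vec \<gamma> \<in> group_algebra D"
  by (auto simp: group_algebra_def basis_vec_def intro!: sum.neutral)

lemma algebra_linear_zero: "algebra_linear D L \<Longrightarrow> L (\<lambda>_. 0) = (\<lambda>_. 0)"
  using algebra_linearD [of D L "\<lambda>_. 0" "\<lambda>_. 0" 0 0] by simp

lemma algebra_linear_scale:
  "algebra_linear D L \<Longrightarrow> v \<in> group_algebra D \<Longrightarrow> L (\<lambda>\<gamma>. a * v \<gamma>) = (\<lambda>\<gamma>. a * L v \<gamma>)"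
  using algebra_linearD [of D L v "\<lambda>_. 0" a 0] by simp

lemma algebra_linear_sum:
  assumes "algebra_linear D L" "finite S" "\<And>i. i \<in> S \<Longrightarrow> f i \<in> group_algebra D"
  shows "L (\<lambda>\<gamma>. \<Sum>i\<in>S. f i \<gamma>) = (\<lambda>\<gamma>. \<Sum>i\<in>S. L (f i) \<gamma>)"
  using assms(2,3)
proof (induction S rule: finite_induct)
  case empty
  then show ?case using assms(1) by (simp add: algebra_linear_zero)
next
  case (insert i S)
  have "L (\<lambda>\<gamma>. 1 * f i \<gamma> + 1 * (\<Sum>i\<in>S. f i \<gamma>)) = (\<lambda>\<gamma>. 1 * L (f i) \<gamma> + 1 * L (\<lambda>\<gamma>. \<Sum>i\<in>S. f i \<gamma>) \<gamma>)"
    using insert.prems by (intro algebra_linearD [OF assms(1)] group_algebra_sum) auto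
  then show ?case using insert by simp
qed

lemma group_algebra_expand:
  assumes "finite (carrier D)" "v \<in> group_algebra D"
  shows "v = (\<lambda>\<beta>. \<Sum>\<gamma>\<in>carrier D. v \<gamma> * basis_vec \<gamma> \<beta>)"
proof
  fix \<beta>
  show "v \<beta> = (\<Sum>\<gamma>\<in>carrier D. v \<gamma> * basis_vec \<gamma> \<beta>)"
    using assms by (auto simp: basis_vec_def group_algebra_def if_distrib cong: if_cong)
qed

lemma algebra_linear_expand:
  assumes "finite (carrier D)" "algebra_linear D L" "v \<in> group_algebra D"
  shows "L v = (\<lambda>\<beta>. \<Sum>\<gamma>\<in>carrier D. v \<gamma> * L (basis_vec \<gamma>) \<beta>)"
proof -
  have "L v = L (\<lambda>\<beta>. \<Sum>\<gamma>\<in>carrier D. v \<gamma> * basis_vec \<gamma> \<beta>)"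
    using group_algebra_expand [OF assms(1,3)] by (rule arg_cong)
  also have "\<dots> = (\<lambda>\<beta>. \<Sum>\<gamma>\<in>carrier D. L (\<lambda>\<beta>. v \<gamma> * basis_vec \<gamma> \<beta>) \<beta>)"
    using assms by (intro algebra_linear_sum group_algebra_scale basis_vec_in_group_algebra)
  also have "\<dots> = (\<lambda>\<beta>. \<Sum>\<gamma>\<in>carrier D. v \<gamma> * L (basis_vec \<gamma>) \<beta>)"
    using assms(2) by (simp add: algebra_linear_scale basis_vec_in_group_algebra)
  finally show ?thesis .
qed

lemma sum_fun_apply: "(\<Sum>i\<in>S. f i) x = (\<Sum>i\<in>S. f i x :: complex)"
  by (induction S rule: infinite_finite_induct) simp_all

text \<open>Finite dimension: the group algebra is the span of finitely many basis vectors inside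
  the space of all functions, so an injective endomorphism is onto.\<close>

lemma algebra_linear_inj_imp_surj:
  fixes D :: "'a monoid"
  assumes fin: "finite (carrier D)" and lin: "algebra_linear D L"
    and closed: "\<And>v. v \<in> group_algebra D \<Longrightarrow> L v \<in> group_algebra D"
    and inj: "\<And>v. v \<in> group_algebra D \<Longrightarrow> L v = (\<lambda>_. 0) \<Longrightarrow> v = (\<lambda>_. 0)"
    and u: "u \<in> group_algebra D"
  shows "\<exists>v \<in> group_algebra D. L v = u"
proof -
  define scale where "scale = (\<lambda>(c :: complex) (f :: 'a \<Rightarrow> complex) x. c * f x)"
  interpret vs: vector_space scale
    by unfold_locales (auto simp: scale_def fun_eq_iff algebra_simps)
  interpret vsp: vector_space_pair scale scale ..
  define B where "B = (basis_vec :: 'a \<Rightarrow> _) ` carrier D"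
  have finB: "finite B" using fin by (simp add: B_def)
  have sub: "vs.subspace (group_algebra D)"
    unfolding vs.subspace_def by (auto simp: group_algebra_def scale_def)
  have spanB: "vs.span B = group_algebra D"
  proof
    show "vs.span B \<subseteq> group_algebra D"
      using basis_vec_in_group_algebra by (intro vs.span_minimal sub) (auto simp: B_def)
    show "group_algebra D \<subseteq> vs.span B"
    proof
      fix v assume v: "v \<in> group_algebra D"
      have "v = (\<Sum>\<gamma>\<in>carrier D. scale (v \<gamma>) (basis_vec \<gamma>))"
        unfolding fun_eq_iff sum_fun_apply scale_def
        using fun_cong [OF group_algebra_expand [OF fin v]] by blast
      also have "\<dots> \<in> vs.span B"
        by (intro vs.span_sum vs.span_scale vs.span_base) (auto simp: B_def)
      finally show "v \<in> vs.span B" .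
    qed
  qed
  \<comment> \<open>L is controlled only on the group algebra; \<open>L'\<close> agrees with it
    there and is linear on all functions.\<close>
  define L' where "L' = (\<lambda>v \<beta>. \<Sum>\<gamma>\<in>carrier D. v \<gamma> * L (basis_vec \<gamma>) \<beta>)"
  have L': "L' v = L v" if "v \<in> group_algebra D" for v
    using algebra_linear_expand [OF fin lin that] by (simp add: L'_def)
  have linL': "Vector_Spaces.linear scale scale L'"
    by unfold_locales
      (auto simp: L'_def scale_def fun_eq_iff sum.distrib sum_distrib_left algebra_simps)
  have injL': "inj_on L' (group_algebra D)"
  proof (rule inj_onI)
    fix v w assume vw: "v \<in> group_algebra D" "w \<in> group_algebra D" "L' v = L' w"
    have "L (\<lambda>\<gamma>. 1 * v \<gamma> + (- 1) * w \<gamma>) = (\<lambda>\<gamma>. 1 * L v \<gamma> + (- 1) * L w \<gamma>)"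
      using vw by (intro algebra_linearD [OF lin])
    also have "\<dots> = (\<lambda>_. 0)"
      using vw by (simp add: L')
    finally have "L (\<lambda>\<gamma>. 1 * v \<gamma> + (- 1) * w \<gamma>) = (\<lambda>_. 0)" .
    then have "(\<lambda>\<gamma>. 1 * v \<gamma> + (- 1) * w \<gamma>) = (\<lambda>_. 0)"
      by (rule inj [OF group_algebra_lincomb [OF vw(1,2)]])
    then show "v = w" by (simp add: fun_eq_iff)
  qed
  have indB: "vs.independent B"
  proof (rule vs.independent_if_scalars_zero [OF finB])
    fix f x assume sum0: "(\<Sum>x\<in>B. scale (f x) x) = 0" and "x \<in> B"
    then obtain \<gamma> where \<gamma>: "\<gamma> \<in> carrier D" "x = basis_vec \<gamma>" by (auto simp: B_def)
    have "inj_on (basis_vec :: 'a \<Rightarrow> _) (carrier D)"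
      by (rule inj_onI) (metis basis_vec_def zero_neq_one)
    then have "0 = (\<Sum>\<delta>\<in>carrier D. scale (f (basis_vec \<delta>)) (basis_vec \<delta>))"
      using sum0 by (simp add: B_def sum.reindex)
    then have "0 = (\<Sum>\<delta>\<in>carrier D. f (basis_vec \<delta>) * basis_vec \<delta> \<gamma>)"
      by (simp add: scale_def fun_eq_iff sum_fun_apply)
    also have "\<dots> = f x"
      using \<gamma> fin by (simp add: basis_vec_def if_distrib cong: if_cong)
    finally show "f x = 0" by simp
  qed
  have indLB: "vs.independent (L' ` B)"
    using vsp.linear_independent_injective_image [OF linL' indB] injL' spanB by simp
  have cardLB: "card (L' ` B) = card B"
    using injL' spanB vs.span_superset by (intro card_image) (metis inj_on_subset)
  \<comment> \<open>Otherwise adding u to the image of the basis would give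
    \<open>card B + 1\<close> independent vectors in the span of B.\<close>
  have "u \<in> vs.span (L' ` B)"
  proof (rule ccontr)
    assume nu: "u \<notin> vs.span (L' ` B)"
    then have "vs.independent (insert u (L' ` B))"
      using indLB by (rule vs.independent_insertI)
    moreover have "L' ` B \<subseteq> group_algebra D"
      using closed by (auto simp: B_def L' basis_vec_in_group_algebra)
    ultimately have "card (insert u (L' ` B)) \<le> card B"
      using u vs.independent_span_bound [OF finB] spanB by auto
    moreover have "u \<notin> L' ` B"
      using nu vs.span_base by blast
    ultimately show False
      using finB cardLB by simp
  qed
  then have "u \<in> L' ` vs.span B"
    using vsp.linear_span_image [OF linL'] by simp
  then show ?thesis
    using spanB L' by auto
qed

section \<open>The action of the generators\<close>

definition weil_const :: "'a monoid \<Rightarrow> ('a \<Rightarrow> rat_mod_int) \<Rightarrow> complex"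
  where "weil_const D Q =
    e_real (- of_int (signature D Q) / 8) / of_real (sqrt (real (card (carrier D))))"

definition weil_T :: "('a \<Rightarrow> rat_mod_int) \<Rightarrow> ('a \<Rightarrow> complex) \<Rightarrow> 'a \<Rightarrow> complex"
  where "weil_T Q v = (\<lambda>\<beta>. e_rmi (Q \<beta>) * v \<beta>)"

text \<open>The action of S in coordinates. The cut-off outside the carrier puts the result into the
  group algebra for every v.\<close>

definition weil_S :: "'a monoid \<Rightarrow> ('a \<Rightarrow> rat_mod_int) \<Rightarrow> ('a \<Rightarrow> complex) \<Rightarrow> 'a \<Rightarrow> complex"
  where "weil_S D Q v = (\<lambda>\<alpha>. if \<alpha> \<in> carrier D
    then weil_const D Q * (\<Sum>\<gamma>\<in>carrier D. e_rmi (- bform D Q \<gamma> \<alpha>) * v \<gamma>) else 0)"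

lemma weil_T_basis: "weil_T Q (basis_vec \<gamma>) = (\<lambda>\<beta>. e_rmi (Q \<gamma>) * basis_vec \<gamma> \<beta>)"
  by (auto simp: weil_T_def basis_vec_def)

lemma weil_S_basis:
  assumes "finite (carrier D)" "\<gamma> \<in> carrier D"
  shows "weil_S D Q (basis_vec \<gamma>) =
    (\<lambda>\<alpha>. e_real (- of_int (signature D Q) / 8) / of_real (sqrt (real (card (carrier D)))) *
        (\<Sum>\<beta>\<in>carrier D. e_rmi (- bform D Q \<gamma> \<beta>) * basis_vec \<beta> \<alpha>))"
proof
  fix \<alpha>
  have "(\<Sum>\<beta>\<in>carrier D. e_rmi (- bform D Q \<gamma> \<beta>) * basis_vec \<beta> \<alpha>) =
      (if \<alpha> \<in> carrier D then e_rmi (- bform D Q \<gamma> \<alpha>) else 0)"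
    using assms by (simp add: basis_vec_def if_distrib cong: if_cong)
  moreover have "(\<Sum>\<delta>\<in>carrier D. e_rmi (- bform D Q \<delta> \<alpha>) * basis_vec \<gamma> \<delta>) = e_rmi (- bform D Q \<gamma> \<alpha>)"
    using assms by (simp add: basis_vec_def if_distrib cong: if_cong)
  ultimately show "weil_S D Q (basis_vec \<gamma>) \<alpha> =
    e_real (- of_int (signature D Q) / 8) / of_real (sqrt (real (card (carrier D)))) *
        (\<Sum>\<beta>\<in>carrier D. e_rmi (- bform D Q \<gamma> \<beta>) * basis_vec \<beta> \<alpha>)"
    by (simp add: weil_S_def weil_const_def)
qed

lemma algebra_linear_weil_T: "algebra_linear D (weil_T Q)"
  by (simp add: algebra_linear_def weil_T_def fun_eq_iff algebra_simps)

lemma algebra_linear_weil_S: "algebra_linear D (weil_S D Q)"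
  by (auto simp: algebra_linear_def weil_S_def fun_eq_iff algebra_simps sum.distrib sum_distrib_left)

lemma algebra_linear_eqI:
  assumes "finite (carrier D)" "algebra_linear D L" "algebra_linear D L'"
    and "\<And>\<gamma>. \<gamma> \<in> carrier D \<Longrightarrow> L (basis_vec \<gamma>) = L' (basis_vec \<gamma>)" and "v \<in> group_algebra D"
  shows "L v = L' v"
  using algebra_linear_expand [OF assms(1,2,5)] algebra_linear_expand [OF assms(1,3,5)] assms(4)
  by simp

lemma weil_T_in_group_algebra: "v \<in> group_algebra D \<Longrightarrow> weil_T Q v \<in> group_algebra D"
  and weil_S_in_group_algebra: "weil_S D Q v \<in> group_algebra D"
  by (simp_all add: group_algebra_def weil_T_def weil_S_def)

lemma weil_representationD:
  assumes "weil_representation D Q \<rho>"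
  shows "\<And>M v. M \<in> SL2Z \<Longrightarrow> v \<in> group_algebra D \<Longrightarrow> \<rho> M v \<in> group_algebra D"
    and "\<And>M. M \<in> SL2Z \<Longrightarrow> algebra_linear D (\<rho> M)"
    and "\<And>v. v \<in> group_algebra D \<Longrightarrow> \<rho> (mat 1) v = v"
    and "\<And>M N v. \<lbrakk>M \<in> SL2Z; N \<in> SL2Z; v \<in> group_algebra D\<rbrakk> \<Longrightarrow> \<rho> (M ** N) v = \<rho> M (\<rho> N v)"
  using assms by (auto simp: weil_representation_def algebra_linear_def)

lemma weil_representation_T_S:
  assumes "finite (carrier D)" "weil_representation D Q \<rho>" "v \<in> group_algebra D"
  shows "\<rho> T_mat v = weil_T Q v" "\<rho> S_mat v = weil_S D Q v"
proof -
  show "\<rho> T_mat v = weil_T Q v"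
    using assms(2) weil_representationD(2) [OF assms(2) T_mat_in_SL2Z]
    by (intro algebra_linear_eqI [OF assms(1) _ algebra_linear_weil_T _ assms(3)])
      (auto simp: weil_representation_def weil_T_basis)
  show "\<rho> S_mat v = weil_S D Q v"
    using assms(1,2) weil_representationD(2) [OF assms(2) S_mat_in_SL2Z]
    by (intro algebra_linear_eqI [OF assms(1) _ algebra_linear_weil_S _ assms(3)])
      (auto simp: weil_representation_def weil_S_basis)
qed

text \<open>The coefficients of L(F) are fixed finite linear combinations of those of F, so
  holomorphy and boundedness persist; the transformation law passes through the intertwining
  relation. The last hypothesis covers all \<rho> because membership in \<open>modular_forms\<close>
  only asserts that some \<rho> exists.\<close>

lemma modular_forms_map:
  assumes fin: "finite (carrier D)" "finite (carrier E)" and F: "F \<in> modular_forms k D Q"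
    and lin: "algebra_linear D L"
    and closed: "\<And>v. v \<in> group_algebra D \<Longrightarrow> L v \<in> group_algebra E"
    and weil: "\<And>\<rho>. weil_representation D Q \<rho> \<Longrightarrow> \<exists>\<rho>'. weil_representation E R \<rho>' \<and>
      (\<forall>M\<in>SL2Z. \<forall>v\<in>group_algebra D. L (\<rho> M v) = \<rho>' M (L v))"
  shows "(\<lambda>\<tau>. L (F \<tau>)) \<in> modular_forms k E R"
proof -
  have alg: "\<And>\<tau>. \<tau> \<in> upper_half_plane \<Longrightarrow> F \<tau> \<in> group_algebra D"
    and hol: "\<And>\<gamma>. \<gamma> \<in> carrier D \<Longrightarrow> (\<lambda>\<tau>. F \<tau> \<gamma>) holomorphic_on upper_half_plane"
    using F by (auto simp: modular_forms_def)
  obtain \<rho> where \<rho>: "weil_representation D Q \<rho>" and trans: "\<And>M \<tau>. M \<in> SL2Z \<Longrightarrow> \<tau> \<in> upper_half_plane \<Longrightarrow>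
      F ((of_int (M $ 1 $ 1) * \<tau> + of_int (M $ 1 $ 2)) /
           (of_int (M $ 2 $ 1) * \<tau> + of_int (M $ 2 $ 2))) =
        (\<lambda>\<gamma>. (of_int (M $ 2 $ 1) * \<tau> + of_int (M $ 2 $ 2)) powi k * \<rho> M (F \<tau>) \<gamma>)"
    using F by (auto simp: modular_forms_def)
  obtain B y where B: "\<And>\<tau> \<gamma>. \<lbrakk>\<tau> \<in> upper_half_plane; Im \<tau> > y; \<gamma> \<in> carrier D\<rbrakk> \<Longrightarrow> norm (F \<tau> \<gamma>) \<le> B"
    using F unfolding modular_forms_def by blast
  obtain \<rho>' where \<rho>': "weil_representation E R \<rho>'"
    and inter: "\<And>M v. M \<in> SL2Z \<Longrightarrow> v \<in> group_algebra D \<Longrightarrow> L (\<rho> M v) = \<rho>' M (L v)"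
    using weil [OF \<rho>] by blast
  have expand: "L (F \<tau>) X = (\<Sum>\<gamma>\<in>carrier D. F \<tau> \<gamma> * L (basis_vec \<gamma>) X)" if "\<tau> \<in> upper_half_plane" for \<tau> X
    using algebra_linear_expand [OF fin(1) lin alg [OF that]] by metis
  have "(\<lambda>\<tau>. L (F \<tau>) X) holomorphic_on upper_half_plane" for X
  proof (rule holomorphic_transform)
    show "(\<lambda>\<tau>. \<Sum>\<gamma>\<in>carrier D. F \<tau> \<gamma> * L (basis_vec \<gamma>) X) holomorphic_on upper_half_plane"
      by (intro holomorphic_intros hol)
  qed (simp add: expand)
  moreover have "\<exists>B y. \<forall>\<tau> \<in> upper_half_plane. Im \<tau> > y \<longrightarrow> (\<forall>X \<in> carrier E. norm (L (F \<tau>) X) \<le> B)"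
  proof -
    have "norm (L (F \<tau>) X) \<le> (\<Sum>\<gamma>\<in>carrier D. \<bar>B\<bar> * norm (L (basis_vec \<gamma>) X))"
      if "\<tau> \<in> upper_half_plane" "Im \<tau> > y" for \<tau> X
    proof -
      have "norm (L (F \<tau>) X) \<le> (\<Sum>\<gamma>\<in>carrier D. norm (F \<tau> \<gamma> * L (basis_vec \<gamma>) X))"
        unfolding expand [OF that(1)] by (rule norm_sum)
      also have "\<dots> \<le> (\<Sum>\<gamma>\<in>carrier D. \<bar>B\<bar> * norm (L (basis_vec \<gamma>) X))"
        using B [OF that] by (intro sum_mono) (force simp: norm_mult intro!: mult_right_mono)
      finally show ?thesis .
    qed
    \<comment> \<open>Uniformity in X: all terms are nonnegative, thanks to the absolute value of B,
      so their sum over X bounds each of them.\<close>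
    moreover have "\<exists>C. \<forall>X\<in>carrier E. (\<Sum>\<gamma>\<in>carrier D. \<bar>B\<bar> * norm (L (basis_vec \<gamma>) X)) \<le> C"
      using fin(2) by (intro exI [of _ "\<Sum>X\<in>carrier E. \<Sum>\<gamma>\<in>carrier D. \<bar>B\<bar> * norm (L (basis_vec \<gamma>) X)"])
        (auto intro!: member_le_sum sum_nonneg)
    ultimately show ?thesis by (meson order_trans)
  qed
  ultimately show ?thesis
    using alg closed \<rho>' trans inter
    by (auto simp: modular_forms_def algebra_linear_scale [OF lin] weil_representationD(1) [OF \<rho>])
qed

section \<open>Lifts from isotropic quotients\<close>

definition alg_up :: "'a monoid \<Rightarrow> ('a \<Rightarrow> rat_mod_int) \<Rightarrow> 'a set \<Rightarrow> ('a set \<Rightarrow> complex) \<Rightarrow> 'a \<Rightarrow> complex"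
  where "alg_up D Q H w = (\<lambda>\<alpha>. if \<alpha> \<in> perp D Q H then w (H #>\<^bsub>D\<^esub> \<alpha>) else 0)"

text \<open>The adjoint of \<open>alg_up\<close> for the standard Hermitian products.\<close>

definition alg_down :: "'a monoid \<Rightarrow> ('a \<Rightarrow> rat_mod_int) \<Rightarrow> 'a set \<Rightarrow> ('a \<Rightarrow> complex) \<Rightarrow> 'a set \<Rightarrow> complex"
  where "alg_down D Q H v = (\<lambda>X. if X \<in> carrier (quot_group D Q H) then \<Sum>\<gamma>\<in>X. v \<gamma> else 0)"

lemma alg_up_lincomb:
  "alg_up D Q H (\<lambda>X. a * v X + b * w X) = (\<lambda>\<alpha>. a * alg_up D Q H v \<alpha> + b * alg_up D Q H w \<alpha>)"
  by (auto simp: alg_up_def)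

lemma algebra_linear_alg_down: "algebra_linear D (alg_down D Q H)"
  by (auto simp: algebra_linear_def alg_down_def fun_eq_iff sum.distrib sum_distrib_left)

lemma alg_up_in_group_algebra: "alg_up D Q H w \<in> group_algebra D"
  by (auto simp: group_algebra_def alg_up_def perp_def)

lemma alg_down_in_group_algebra: "alg_down D Q H v \<in> group_algebra (quot_group D Q H)"
  by (simp add: group_algebra_def alg_down_def)

context discriminant_form
begin

text \<open>Orthogonality of characters: translation by an a with \<open>f a\<close> nonzero
  multiplies the sum by \<open>e_rmi (f a)\<close>, which is not 1.\<close>

lemma sum_e_rmi_additive:
  assumes A: "subgroup A D"
    and add: "\<And>x y. x \<in> A \<Longrightarrow> y \<in> A \<Longrightarrow> f (x \<otimes> y) = f x + (f y :: rat_mod_int)"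
  shows "(\<Sum>x\<in>A. e_rmi (f x)) = (if \<forall>x\<in>A. f x = 0 then of_nat (card A) else 0)"
proof (cases "\<forall>x\<in>A. f x = 0")
  case True
  then show ?thesis by simp
next
  case False
  interpret A: subgroup A D by (rule A)
  obtain a where a: "a \<in> A" "f a \<noteq> 0" using False by blast
  have "bij_betw (\<lambda>x. a \<otimes> x) A A"
    using a by (intro bij_betw_byWitness [where f' = "\<lambda>x. inv a \<otimes> x"])
      (auto simp: m_assoc [symmetric])
  then have "(\<Sum>x\<in>A. e_rmi (f x)) = (\<Sum>x\<in>A. e_rmi (f (a \<otimes> x)))"
    by (rule sum.reindex_bij_betw [symmetric])
  also have "\<dots> = e_rmi (f a) * (\<Sum>x\<in>A. e_rmi (f x))"
    using a add by (simp add: e_rmi_add sum_distrib_left)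
  finally have "(\<Sum>x\<in>A. e_rmi (f x)) = 0"
    using a e_rmi_eq_1_iff [of "f a"] by auto
  with False show ?thesis by auto
qed

end

section \<open>The quotient by an isotropic subgroup, its order and its signature\<close>

locale isotropic_subgroup = discriminant_form D Q for D :: "'a monoid" (structure) and Q +
  fixes H :: "'a set"
  assumes isotropic: "isotropic D Q H"
begin

abbreviation "E \<equiv> quot_group D Q H"
abbreviation "q \<equiv> quot_form Q :: 'a set \<Rightarrow> rat_mod_int"
abbreviation "Hp \<equiv> perp D Q H"

lemma subgroup_H: "subgroup H D"
  using isotropic by (simp add: isotropic_def)

sublocale H: subgroup H D
  by (rule subgroup_H)

lemma Q_H: "h \<in> H \<Longrightarrow> Q h = 0"
  using isotropic by (simp add: isotropic_def)

lemma finite_H: "finite H"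
  using H.subset finite_carrier by (rule finite_subset)

lemma card_H_pos: "card H > 0"
  using finite_H H.one_closed by (metis card_gt_0_iff empty_iff)

lemma perpD: "\<gamma> \<in> Hp \<Longrightarrow> \<gamma> \<in> carrier D" "\<gamma> \<in> Hp \<Longrightarrow> h \<in> H \<Longrightarrow> bform D Q \<gamma> h = 0"
  "\<gamma> \<in> Hp \<Longrightarrow> h \<in> H \<Longrightarrow> bform D Q h \<gamma> = 0"
  by (auto simp: perp_def bform_sym)

lemma finite_perp: "finite Hp"
  using finite_carrier by (rule rev_finite_subset) (auto simp: perp_def)

lemma perp_subgroup: "subgroup Hp D"
proof (rule subgroupI)
  show "Hp \<noteq> {}"
    by (auto simp: perp_def intro!: exI [of _ \<one>])
qed (auto simp: perp_def bform_inv_left bform_left)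

lemma H_subset_perp: "H \<subseteq> Hp"
  unfolding perp_def bform_def by (simp add: Q_H subset_iff)

lemma in_perp_iff: "\<alpha> \<in> carrier D \<Longrightarrow> \<alpha> \<in> Hp \<longleftrightarrow> (\<forall>h\<in>H. bform D Q h \<alpha> = 0)"
  by (auto simp: perp_def bform_sym)

sublocale P: subgroup Hp D
  by (rule perp_subgroup)

lemma coset_eq: "H #> \<gamma> = (\<lambda>h. h \<otimes> \<gamma>) ` H"
  by (auto simp: r_coset_def)

lemma sum_coset:
  assumes "\<gamma> \<in> carrier D"
  shows "(\<Sum>\<delta>\<in>H #> \<gamma>. f \<delta>) = (\<Sum>h\<in>H. f (h \<otimes> \<gamma>))"
proof -
  have "inj_on (\<lambda>h. h \<otimes> \<gamma>) H"
    using assms by (auto intro!: inj_onI)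
  then show ?thesis by (simp add: coset_eq sum.reindex)
qed

lemma carrier_quot: "carrier E = (\<lambda>\<gamma>. H #> \<gamma>) ` Hp"
  by (auto simp: quot_group_def FactGroup_def RCOSETS_def r_coset_def)

lemma finite_quot: "finite (carrier E)"
  using finite_perp by (simp add: carrier_quot)

lemma coset_in_quot: "\<gamma> \<in> Hp \<Longrightarrow> H #> \<gamma> \<in> carrier E"
  by (simp add: carrier_quot)

lemma quot_cases:
  assumes "X \<in> carrier E"
  obtains \<gamma> where "\<gamma> \<in> Hp" "X = H #> \<gamma>"
  using assms by (auto simp: carrier_quot)

lemma mult_quot:
  assumes "\<gamma> \<in> Hp" "\<delta> \<in> Hp"
  shows "(H #> \<gamma>) \<otimes>\<^bsub>E\<^esub> (H #> \<delta>) = H #> (\<gamma> \<otimes> \<delta>)"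
proof -
  have "normal H D"
    by (rule subgroup_imp_normal [OF subgroup_H])
  then have "(H #> \<gamma>) <#> (H #> \<delta>) = H #> (\<gamma> \<otimes> \<delta>)"
    using assms by (simp add: normal.rcos_sum)
  then show ?thesis
    by (simp add: quot_group_def FactGroup_def set_mult_def)
qed

lemma Q_coset:
  assumes "\<gamma> \<in> Hp" "\<delta> \<in> H #> \<gamma>"
  shows "Q \<delta> = Q \<gamma>"
  using assms Q_H perpD by (auto simp: coset_eq Q_mult)

lemma quot_form_coset:
  assumes "\<gamma> \<in> Hp"
  shows "q (H #> \<gamma>) = Q \<gamma>"
  unfolding quot_form_def
proof (rule the_elem_image_unique)
  show "H #> \<gamma> \<noteq> {}"
    using rcos_self [OF P.mem_carrier [OF assms] subgroup_H] by blast
qed (rule Q_coset [OF assms])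

lemma bform_quot:
  assumes "\<gamma> \<in> Hp" "\<delta> \<in> Hp"
  shows "bform E q (H #> \<gamma>) (H #> \<delta>) = bform D Q \<gamma> \<delta>"
  using assms by (simp add: bform_def mult_quot quot_form_coset)

lemma coset_fiber:
  assumes "X \<in> carrier E"
  shows "{\<gamma> \<in> Hp. H #> \<gamma> = X} = X"
proof -
  obtain \<gamma> where g: "\<gamma> \<in> Hp" "X = H #> \<gamma>" using assms by (rule quot_cases)
  show ?thesis
  proof (intro equalityI subsetI)
    fix x assume "x \<in> {\<gamma> \<in> Hp. H #> \<gamma> = X}"
    then show "x \<in> X" using rcos_self [OF P.mem_carrier subgroup_H, of x] by simp
  next
    fix x assume x: "x \<in> X"
    then have "x \<in> Hp"
      using g H_subset_perp by (auto simp: coset_eq)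
    moreover have "H #> x = X"
      using x g repr_independence [OF _ _ subgroup_H, of x \<gamma>] by auto
    ultimately show "x \<in> {\<gamma> \<in> Hp. H #> \<gamma> = X}" by simp
  qed
qed

lemma quot_memberD:
  assumes "X \<in> carrier E" "x \<in> X"
  shows "x \<in> Hp" "H #> x = X"
  using assms coset_fiber by blast+

lemma sum_perp: "(\<Sum>\<gamma>\<in>Hp. f \<gamma>) = (\<Sum>X\<in>carrier E. \<Sum>\<gamma>\<in>X. f \<gamma>)"
proof -
  have "(\<Sum>\<gamma>\<in>Hp. f \<gamma>) = (\<Sum>X\<in>carrier E. \<Sum>\<gamma>\<in>{\<gamma> \<in> Hp. H #> \<gamma> = X}. f \<gamma>)"
    using finite_perp finite_quot coset_in_quot by (intro sum.group [symmetric]) auto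
  then show ?thesis by (simp add: coset_fiber)
qed

text \<open>Pairing with \<alpha> is a character of H, trivial exactly for \<alpha> in the
  orthogonal complement.\<close>

lemma sum_e_rmi_H:
  assumes "\<alpha> \<in> carrier D"
  shows "(\<Sum>h\<in>H. e_rmi (bform D Q h \<alpha>)) = (if \<alpha> \<in> Hp then of_nat (card H) else 0)"
    and "(\<Sum>h\<in>H. e_rmi (- bform D Q h \<alpha>)) = (if \<alpha> \<in> Hp then of_nat (card H) else 0)"
proof -
  show "(\<Sum>h\<in>H. e_rmi (bform D Q h \<alpha>)) = (if \<alpha> \<in> Hp then of_nat (card H) else 0)"
    "(\<Sum>h\<in>H. e_rmi (- bform D Q h \<alpha>)) = (if \<alpha> \<in> Hp then of_nat (card H) else 0)"
    using sum_e_rmi_additive [OF subgroup_H, of "\<lambda>h. bform D Q h \<alpha>"]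
      sum_e_rmi_additive [OF subgroup_H, of "\<lambda>h. - bform D Q h \<alpha>"] assms
    by (simp_all add: bform_left in_perp_iff)
qed

lemma card_quot_perp: "card (carrier E) * card H = card Hp"
proof -
  have "card X = card H" if "X \<in> carrier E" for X
  proof -
    from that obtain \<gamma> where "\<gamma> \<in> Hp" "X = H #> \<gamma>" by (rule quot_cases)
    then show ?thesis using sum_coset [of \<gamma> "\<lambda>_. 1 :: nat"] by simp
  qed
  then show ?thesis
    using sum_perp [of "\<lambda>_. 1 :: nat"] by simp
qed

text \<open>Double counting of the sum of \<open>e_rmi (bform D Q h \<alpha>)\<close> over all h in
  H and \<alpha> in D: summing over h first leaves the \<alpha> in \<open>Hp\<close>; summing over
  \<alpha> first leaves h = 1, by nondegeneracy.\<close>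

lemma card_perp: "card Hp * card H = card (carrier D)"
proof -
  have carr: "subgroup (carrier D) D" by (rule subgroup_self)
  have "of_nat (card Hp * card H) = (\<Sum>\<alpha>\<in>Hp. of_nat (card H) :: complex)"
    by simp
  also have "\<dots> = (\<Sum>\<alpha>\<in>carrier D. if \<alpha> \<in> Hp then of_nat (card H) else 0)"
    using finite_carrier P.subset by (simp add: sum.inter_restrict [symmetric] Int_absorb1)
  also have "\<dots> = (\<Sum>\<alpha>\<in>carrier D. \<Sum>h\<in>H. e_rmi (bform D Q h \<alpha>))"
    by (simp add: sum_e_rmi_H)
  also have "\<dots> = (\<Sum>h\<in>H. \<Sum>\<alpha>\<in>carrier D. e_rmi (bform D Q h \<alpha>))"
    by (rule sum.swap)
  also have "\<dots> = (\<Sum>h\<in>H. if h = \<one> then of_nat (card (carrier D)) else 0)"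
  proof (rule sum.cong [OF refl])
    fix h assume h: "h \<in> H"
    have "(\<forall>\<alpha>\<in>carrier D. bform D Q h \<alpha> = 0) \<longleftrightarrow> h = \<one>"
      using h nondegenerate by auto
    then show "(\<Sum>\<alpha>\<in>carrier D. e_rmi (bform D Q h \<alpha>)) = (if h = \<one> then of_nat (card (carrier D)) else 0)"
      using sum_e_rmi_additive [OF carr, of "bform D Q h"] h by (simp add: bform_right)
  qed
  also have "\<dots> = of_nat (card (carrier D))"
    using finite_H by simp
  finally show ?thesis by (simp only: of_nat_eq_iff)
qed

lemma sqrt_card: "of_real (sqrt (real (card (carrier D)))) =
    (of_nat (card H) * of_real (sqrt (real (card (carrier E)))) :: complex)"
proof -
  have "card (carrier D) = card (carrier E) * (card H)\<^sup>2"
    by (simp add: card_perp [symmetric] card_quot_perp [symmetric] power2_eq_square)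
  then show ?thesis
    by (simp add: real_sqrt_mult)
qed

text \<open>Average the Gauss sum over translates by H. As Q(h + \<gamma>) = Q(\<gamma>) + (h,
  \<gamma>), the character sum over H removes all \<gamma> outside \<open>Hp\<close>, and on
  \<open>Hp\<close> the summand is constant on cosets.\<close>

lemma gauss_sum_quot:
  "(\<Sum>\<gamma>\<in>carrier D. e_rmi (Q \<gamma>)) = of_nat (card H) * (\<Sum>X\<in>carrier E. e_rmi (q X))"
proof -
  have "of_nat (card H) * (\<Sum>\<gamma>\<in>carrier D. e_rmi (Q \<gamma>)) = (\<Sum>h\<in>H. \<Sum>\<gamma>\<in>carrier D. e_rmi (Q \<gamma>))"
    by simp
  also have "\<dots> = (\<Sum>h\<in>H. \<Sum>\<gamma>\<in>carrier D. e_rmi (Q (h \<otimes> \<gamma>)))"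
  proof (rule sum.cong [OF refl])
    fix h assume h: "h \<in> H"
    have "bij_betw (\<lambda>x. h \<otimes> x) (carrier D) (carrier D)"
      using h by (intro bij_betw_byWitness [where f' = "\<lambda>x. inv h \<otimes> x"])
        (auto simp: m_assoc [symmetric])
    then show "(\<Sum>\<gamma>\<in>carrier D. e_rmi (Q \<gamma>)) = (\<Sum>\<gamma>\<in>carrier D. e_rmi (Q (h \<otimes> \<gamma>)))"
      by (rule sum.reindex_bij_betw [symmetric])
  qed
  also have "\<dots> = (\<Sum>\<gamma>\<in>carrier D. \<Sum>h\<in>H. e_rmi (Q (h \<otimes> \<gamma>)))"
    by (rule sum.swap)
  also have "\<dots> = (\<Sum>\<gamma>\<in>carrier D. e_rmi (Q \<gamma>) * (\<Sum>h\<in>H. e_rmi (bform D Q h \<gamma>)))"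
    by (simp add: Q_mult Q_H e_rmi_add sum_distrib_left)
  also have "\<dots> = (\<Sum>\<gamma>\<in>carrier D. if \<gamma> \<in> Hp then of_nat (card H) * e_rmi (Q \<gamma>) else 0)"
    by (intro sum.cong refl) (simp add: sum_e_rmi_H)
  also have "\<dots> = of_nat (card H) * (\<Sum>\<gamma>\<in>Hp. e_rmi (Q \<gamma>))"
    using finite_carrier P.subset
    by (simp add: sum.inter_restrict [symmetric] Int_absorb1 sum_distrib_left)
  also have "(\<Sum>\<gamma>\<in>Hp. e_rmi (Q \<gamma>)) = (\<Sum>X\<in>carrier E. \<Sum>\<gamma>\<in>X. e_rmi (Q \<gamma>))"
    by (rule sum_perp)
  also have "\<dots> = (\<Sum>X\<in>carrier E. of_nat (card H) * e_rmi (q X))"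
  proof (rule sum.cong [OF refl])
    fix X assume "X \<in> carrier E"
    then obtain \<gamma> where g: "\<gamma> \<in> Hp" "X = H #> \<gamma>" by (rule quot_cases)
    have "(\<Sum>\<delta>\<in>X. e_rmi (Q \<delta>)) = (\<Sum>h\<in>H. e_rmi (Q (h \<otimes> \<gamma>)))"
      unfolding g using g by (intro sum_coset) auto
    also have "\<dots> = of_nat (card H) * e_rmi (q X)"
      using g by (simp add: Q_mult Q_H perpD quot_form_coset)
    finally show "(\<Sum>\<delta>\<in>X. e_rmi (Q \<delta>)) = of_nat (card H) * e_rmi (q X)" .
  qed
  finally show ?thesis
    using card_H_pos by (simp add: sum_distrib_left [symmetric])
qed

text \<open>From the quotient to D, the Gauss sum and the square root of the order both grow by the
  factor \<open>card H\<close>.\<close>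

lemma signature_quot: "signature E q = signature D Q"
proof -
  have "has_signature E q s \<longleftrightarrow> has_signature D Q s" for s
    unfolding has_signature_def gauss_sum_quot sqrt_card using card_H_pos by simp
  then show ?thesis by (simp add: signature_def)
qed

text \<open>Since the signatures agree, only the square roots differ. The factor
  \<open>card H\<close> is the one that character sums over cosets of H produce in
  \<open>up_S\<close> and \<open>down_S\<close>.\<close>

lemma weil_const_quot: "weil_const E q = of_nat (card H) * weil_const D Q"
  unfolding weil_const_def signature_quot sqrt_card using card_H_pos by simp

lemma sum_coset_e_rmi:
  assumes "\<gamma> \<in> carrier D" "\<alpha> \<in> carrier D"
  shows "(\<Sum>\<delta>\<in>H #> \<gamma>. e_rmi (- bform D Q \<delta> \<alpha>)) =
    (if \<alpha> \<in> Hp then of_nat (card H) * e_rmi (- bform D Q \<gamma> \<alpha>) else 0)"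
proof -
  have "(\<Sum>\<delta>\<in>H #> \<gamma>. e_rmi (- bform D Q \<delta> \<alpha>)) = (\<Sum>h\<in>H. e_rmi (- bform D Q h \<alpha> + - bform D Q \<gamma> \<alpha>))"
    using assms by (simp add: sum_coset bform_left)
  also have "\<dots> = (\<Sum>h\<in>H. e_rmi (- bform D Q h \<alpha>)) * e_rmi (- bform D Q \<gamma> \<alpha>)"
    by (simp only: e_rmi_add sum_distrib_right)
  finally show ?thesis using assms by (simp add: sum_e_rmi_H)
qed

section \<open>Compatibility of lifting and descending with T and S\<close>

lemma up_T: "alg_up D Q H (weil_T q w) = weil_T Q (alg_up D Q H w)"
  by (auto simp: alg_up_def weil_T_def quot_form_coset)

text \<open>A lift is constant on the cosets in \<open>Hp\<close>, so S sums the character over each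
  coset: this gives 0 unless \<alpha> is in \<open>Hp\<close>, and otherwise the factor
  \<open>card H\<close> that is absorbed by \<open>weil_const_quot\<close>.\<close>

lemma up_S: "alg_up D Q H (weil_S E q w) = weil_S D Q (alg_up D Q H w)"
proof
  fix \<alpha>
  show "alg_up D Q H (weil_S E q w) \<alpha> = weil_S D Q (alg_up D Q H w) \<alpha>"
  proof (cases "\<alpha> \<in> carrier D")
    case False
    then have "\<alpha> \<notin> Hp" using P.mem_carrier by blast
    with False show ?thesis by (simp add: alg_up_def weil_S_def)
  next
    case True
    have "(\<Sum>\<gamma>\<in>carrier D. e_rmi (- bform D Q \<gamma> \<alpha>) * alg_up D Q H w \<gamma>) =
        (\<Sum>\<gamma>\<in>carrier D. if \<gamma> \<in> Hp then e_rmi (- bform D Q \<gamma> \<alpha>) * w (H #> \<gamma>) else 0)"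
      by (intro sum.cong refl) (simp add: alg_up_def)
    also have "\<dots> = (\<Sum>\<gamma>\<in>Hp. e_rmi (- bform D Q \<gamma> \<alpha>) * w (H #> \<gamma>))"
      using finite_carrier P.subset by (simp add: sum.inter_restrict [symmetric] Int_absorb1)
    also have "\<dots> = (\<Sum>X\<in>carrier E. \<Sum>\<gamma>\<in>X. e_rmi (- bform D Q \<gamma> \<alpha>) * w (H #> \<gamma>))"
      by (rule sum_perp)
    also have "\<dots> = (\<Sum>X\<in>carrier E. \<Sum>\<gamma>\<in>X. e_rmi (- bform D Q \<gamma> \<alpha>) * w X)"
      by (intro sum.cong refl) (simp add: quot_memberD)
    also have "\<dots> = (\<Sum>X\<in>carrier E. (\<Sum>\<gamma>\<in>X. e_rmi (- bform D Q \<gamma> \<alpha>)) * w X)"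
      by (simp add: sum_distrib_right)
    also have "\<dots> = (\<Sum>X\<in>carrier E. if \<alpha> \<in> Hp then of_nat (card H) * (e_rmi (- bform E q X (H #> \<alpha>)) * w X) else 0)"
    proof (rule sum.cong [OF refl])
      fix X assume "X \<in> carrier E"
      then obtain \<gamma> where "\<gamma> \<in> Hp" "X = H #> \<gamma>" by (rule quot_cases)
      then show "(\<Sum>\<gamma>\<in>X. e_rmi (- bform D Q \<gamma> \<alpha>)) * w X =
          (if \<alpha> \<in> Hp then of_nat (card H) * (e_rmi (- bform E q X (H #> \<alpha>)) * w X) else 0)"
        using True by (simp add: sum_coset_e_rmi bform_quot)
    qed
    finally show ?thesis
      using True
      by (simp add: weil_S_def alg_up_def coset_in_quot weil_const_quot sum_distrib_left mult_ac)
  qed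
qed

lemma down_T: "alg_down D Q H (weil_T Q v) = weil_T q (alg_down D Q H v)"
proof
  fix X
  show "alg_down D Q H (weil_T Q v) X = weil_T q (alg_down D Q H v) X"
  proof (cases "X \<in> carrier E")
    case True
    then obtain \<gamma> where g: "\<gamma> \<in> Hp" "X = H #> \<gamma>" by (rule quot_cases)
    have "Q \<delta> = q X" if "\<delta> \<in> X" for \<delta>
      using g that by (simp add: Q_coset quot_form_coset)
    then show ?thesis
      using True by (simp add: alg_down_def weil_T_def sum_distrib_left)
  qed (simp add: alg_down_def weil_T_def)
qed

text \<open>Dual to \<open>up_S\<close>: the character is now summed over the coset X at which the
  result is evaluated, which discards all \<gamma> outside \<open>Hp\<close>.\<close>

lemma down_S: "alg_down D Q H (weil_S D Q v) = weil_S E q (alg_down D Q H v)"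
proof
  fix X
  show "alg_down D Q H (weil_S D Q v) X = weil_S E q (alg_down D Q H v) X"
  proof (cases "X \<in> carrier E")
    case True
    then obtain \<alpha> where a: "\<alpha> \<in> Hp" "X = H #> \<alpha>" by (rule quot_cases)
    have XD: "\<delta> \<in> carrier D" if "\<delta> \<in> X" for \<delta>
      using quot_memberD(1) [OF True that] by simp
    have "alg_down D Q H (weil_S D Q v) X = (\<Sum>\<delta>\<in>X. weil_S D Q v \<delta>)"
      using True by (simp add: alg_down_def)
    also have "\<dots> =
        weil_const D Q * (\<Sum>\<delta>\<in>X. \<Sum>\<gamma>\<in>carrier D. e_rmi (- bform D Q \<gamma> \<delta>) * v \<gamma>)"
      by (simp add: weil_S_def XD sum_distrib_left)
    also have "(\<Sum>\<delta>\<in>X. \<Sum>\<gamma>\<in>carrier D. e_rmi (- bform D Q \<gamma> \<delta>) * v \<gamma>) =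
        (\<Sum>\<gamma>\<in>carrier D. \<Sum>\<delta>\<in>X. e_rmi (- bform D Q \<gamma> \<delta>) * v \<gamma>)"
      by (rule sum.swap)
    also have "\<dots> = (\<Sum>\<gamma>\<in>carrier D. (\<Sum>\<delta>\<in>H #> \<alpha>. e_rmi (- bform D Q \<delta> \<gamma>)) * v \<gamma>)"
      unfolding sum_distrib_right a(2) [symmetric] using XD by (intro sum.cong refl) (simp add: bform_sym)
    also have "\<dots> = (\<Sum>\<gamma>\<in>carrier D. if \<gamma> \<in> Hp then of_nat (card H) * (e_rmi (- bform D Q \<gamma> \<alpha>) * v \<gamma>) else 0)"
      using a by (intro sum.cong refl) (simp add: sum_coset_e_rmi bform_sym)
    also have "\<dots> = (\<Sum>\<gamma>\<in>Hp. of_nat (card H) * (e_rmi (- bform D Q \<gamma> \<alpha>) * v \<gamma>))"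
      using finite_carrier P.subset by (simp add: sum.inter_restrict [symmetric] Int_absorb1)
    also have "\<dots> = (\<Sum>Y\<in>carrier E. \<Sum>\<gamma>\<in>Y. of_nat (card H) * (e_rmi (- bform D Q \<gamma> \<alpha>) * v \<gamma>))"
      by (rule sum_perp)
    also have "\<dots> = (\<Sum>Y\<in>carrier E. of_nat (card H) * (e_rmi (- bform E q Y X) * alg_down D Q H v Y))"
    proof (rule sum.cong [OF refl])
      fix Y assume Y: "Y \<in> carrier E"
      have "bform D Q \<gamma> \<alpha> = bform E q Y X" if "\<gamma> \<in> Y" for \<gamma>
        using quot_memberD [OF Y that] a bform_quot [of \<gamma> \<alpha>] by simp
      then show "(\<Sum>\<gamma>\<in>Y. of_nat (card H) * (e_rmi (- bform D Q \<gamma> \<alpha>) * v \<gamma>)) =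
          of_nat (card H) * (e_rmi (- bform E q Y X) * alg_down D Q H v Y)"
        using Y by (simp add: alg_down_def sum_distrib_left)
    qed
    finally show ?thesis
      using True
      by (simp add: weil_S_def [of E] weil_const_quot sum_distrib_left mult_ac)
  qed (simp add: alg_down_def weil_S_def)
qed

section \<open>The Weil representation induced on the quotient\<close>

lemma down_up:
  assumes "w \<in> group_algebra E"
  shows "alg_down D Q H (alg_up D Q H w) = (\<lambda>X. of_nat (card H) * w X)"
proof
  fix X
  show "alg_down D Q H (alg_up D Q H w) X = of_nat (card H) * w X"
  proof (cases "X \<in> carrier E")
    case True
    then obtain \<gamma> where g: "\<gamma> \<in> Hp" "X = H #> \<gamma>" by (rule quot_cases)
    have "alg_up D Q H w \<delta> = w X" if "\<delta> \<in> X" for \<delta>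
      using quot_memberD [OF True that] by (simp add: alg_up_def)
    moreover have "card X = card H"
      using sum_coset [of \<gamma> "\<lambda>_. 1 :: nat"] g by simp
    ultimately show ?thesis using True by (simp add: alg_down_def)
  next
    case False
    then show ?thesis using assms by (simp add: alg_down_def group_algebra_def)
  qed
qed

text \<open>By \<open>down_up\<close>, \<open>alg_down\<close> divided by \<open>card H\<close> is a
  left inverse of \<open>alg_up\<close>, so this transports \<rho> to the quotient. It is the
  witness for the existential in \<open>modular_forms\<close> of the quotient.\<close>

definition quot_rep :: "(int ^ 2 ^ 2 \<Rightarrow> ('a \<Rightarrow> complex) \<Rightarrow> 'a \<Rightarrow> complex) \<Rightarrow>
    int ^ 2 ^ 2 \<Rightarrow> ('a set \<Rightarrow> complex) \<Rightarrow> 'a set \<Rightarrow> complex"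
  where "quot_rep \<rho> M w = (\<lambda>X. inverse (of_nat (card H)) * alg_down D Q H (\<rho> M (alg_up D Q H w)) X)"

text \<open>Whenever \<rho> maps a lift to a lift, the preimage of the result is the value of
  \<open>quot_rep\<close>.\<close>

lemma quot_rep_eqI:
  assumes "w' \<in> group_algebra E" "\<rho> M (alg_up D Q H w) = alg_up D Q H w'"
  shows "quot_rep \<rho> M w = w'"
  using assms card_H_pos by (simp add: quot_rep_def down_up mult.assoc [symmetric])

lemma quot_rep_in_group_algebra: "quot_rep \<rho> M w \<in> group_algebra E"
  unfolding quot_rep_def by (intro group_algebra_scale alg_down_in_group_algebra)

context
  fixes \<rho> :: "int ^ 2 ^ 2 \<Rightarrow> ('a \<Rightarrow> complex) \<Rightarrow> 'a \<Rightarrow> complex"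
  assumes weil: "weil_representation D Q \<rho>"
begin

text \<open>The image of \<open>alg_up\<close> is stable under S and T by \<open>up_S\<close> and
  \<open>up_T\<close>, hence under the whole modular group, and on this image the division in
  \<open>quot_rep\<close> really inverts \<open>alg_up\<close>.\<close>

lemma up_quot_rep:
  assumes "M \<in> SL2Z" "w \<in> group_algebra E"
  shows "alg_up D Q H (quot_rep \<rho> M w) = \<rho> M (alg_up D Q H w)"
proof -
  note ts = weil_representation_T_S [OF finite_carrier weil]
  note up = alg_up_in_group_algebra [of D Q H]
  have "\<exists>w'\<in>group_algebra E. \<rho> M (alg_up D Q H w) = alg_up D Q H w'"
    using assms(1)
  proof (induction rule: SL2Z_induct)
    case one
    then show ?case using assms(2) weil_representationD(3) [OF weil up] by blast
  next
    case (S M)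
    then obtain w' where w': "w' \<in> group_algebra E" "\<rho> M (alg_up D Q H w) = alg_up D Q H w'" by blast
    have "\<rho> (S_mat ** M) (alg_up D Q H w) = alg_up D Q H (weil_S E q w')"
      using S w' weil_representationD(4) [OF weil S_mat_in_SL2Z S.hyps up]
      by (simp add: ts [OF up] up_S)
    then show ?case using weil_S_in_group_algebra by blast
  next
    case (T M)
    then obtain w' where w': "w' \<in> group_algebra E" "\<rho> M (alg_up D Q H w) = alg_up D Q H w'" by blast
    have "\<rho> (T_mat ** M) (alg_up D Q H w) = alg_up D Q H (weil_T q w')"
      using T w' weil_representationD(4) [OF weil T_mat_in_SL2Z T.hyps up]
      by (simp add: ts [OF up] up_T)
    then show ?case using w' weil_T_in_group_algebra by blast
  qed
  then show ?thesis using quot_rep_eqI by metis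
qed

lemma quot_rep_gens:
  assumes "w \<in> group_algebra E"
  shows "quot_rep \<rho> T_mat w = weil_T q w" "quot_rep \<rho> S_mat w = weil_S E q w"
  using assms weil_representation_T_S [OF finite_carrier weil alg_up_in_group_algebra [of D Q H w]]
  by (auto intro!: quot_rep_eqI simp: up_T up_S weil_T_in_group_algebra weil_S_in_group_algebra)

lemma quot_rep_one: "w \<in> group_algebra E \<Longrightarrow> quot_rep \<rho> (mat 1) w = w"
  using weil_representationD(3) [OF weil alg_up_in_group_algebra] by (intro quot_rep_eqI)

lemma quot_rep_mult:
  assumes "M \<in> SL2Z" "N \<in> SL2Z" "w \<in> group_algebra E"
  shows "quot_rep \<rho> (M ** N) w = quot_rep \<rho> M (quot_rep \<rho> N w)"
proof (rule quot_rep_eqI [OF quot_rep_in_group_algebra])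
  show "\<rho> (M ** N) (alg_up D Q H w) = alg_up D Q H (quot_rep \<rho> M (quot_rep \<rho> N w))"
    using assms
    by (simp add: up_quot_rep quot_rep_in_group_algebra
        weil_representationD(4) [OF weil _ _ alg_up_in_group_algebra])
qed

lemma algebra_linear_quot_rep:
  assumes "M \<in> SL2Z"
  shows "algebra_linear E (quot_rep \<rho> M)"
  unfolding algebra_linear_def quot_rep_def
  using assms weil_representationD(1,2) [OF weil]
  by (simp add: alg_up_lincomb algebra_linearD [OF algebra_linear_alg_down]
      algebra_linearD [of D "\<rho> M"] alg_up_in_group_algebra algebra_simps)

lemma weil_representation_quot: "weil_representation E q (quot_rep \<rho>)"
  unfolding weil_representation_def
  using algebra_linear_quot_rep
  by (intro conjI)
    (auto simp: quot_rep_in_group_algebra quot_rep_one quot_rep_mult quot_rep_gens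
      basis_vec_in_group_algebra weil_T_basis weil_S_basis finite_quot algebra_linear_def)

text \<open>The relations \<open>down_S\<close> and \<open>down_T\<close> spread to the modular
  group by induction over words in S and T.\<close>

lemma down_quot_rep:
  assumes "M \<in> SL2Z" "v \<in> group_algebra D"
  shows "alg_down D Q H (\<rho> M v) = quot_rep \<rho> M (alg_down D Q H v)"
  using assms(1)
proof (induction rule: SL2Z_induct)
  case one
  then show ?case
    using assms(2) by (simp add: weil_representationD(3) [OF weil] quot_rep_one alg_down_in_group_algebra)
next
  case (S M)
  then show ?case
    using assms(2) weil_representationD(1) [OF weil]
    by (simp add: weil_representationD(4) [OF weil] quot_rep_mult S_mat_in_SL2Z
        weil_representation_T_S [OF finite_carrier weil] quot_rep_gens
        alg_down_in_group_algebra quot_rep_in_group_algebra down_S)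
next
  case (T M)
  then show ?case
    using assms(2) weil_representationD(1) [OF weil]
    by (simp add: weil_representationD(4) [OF weil] quot_rep_mult T_mat_in_SL2Z
        weil_representation_T_S [OF finite_carrier weil] quot_rep_gens
        alg_down_in_group_algebra quot_rep_in_group_algebra down_T)
qed

end

text \<open>Adjointness with both arguments built from the same v; the result is a sum of squares,
  which makes \<open>old_operator\<close> positive.\<close>

lemma down_adjoint_up:
  "(\<Sum>\<alpha>\<in>carrier D. cnj (v \<alpha>) * alg_up D Q H (alg_down D Q H v) \<alpha>) =
    of_real (\<Sum>X\<in>carrier E. (norm (alg_down D Q H v X))\<^sup>2)"
proof -
  have "(\<Sum>\<alpha>\<in>carrier D. cnj (v \<alpha>) * alg_up D Q H (alg_down D Q H v) \<alpha>) =
      (\<Sum>\<alpha>\<in>carrier D. if \<alpha> \<in> Hp then cnj (v \<alpha>) * alg_down D Q H v (H #> \<alpha>) else 0)"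
    by (intro sum.cong refl) (simp add: alg_up_def)
  also have "\<dots> = (\<Sum>\<alpha>\<in>Hp. cnj (v \<alpha>) * alg_down D Q H v (H #> \<alpha>))"
    using finite_carrier P.subset by (simp add: sum.inter_restrict [symmetric] Int_absorb1)
  also have "\<dots> = (\<Sum>X\<in>carrier E. \<Sum>\<alpha>\<in>X. cnj (v \<alpha>) * alg_down D Q H v (H #> \<alpha>))"
    by (rule sum_perp)
  also have "\<dots> = (\<Sum>X\<in>carrier E. \<Sum>\<alpha>\<in>X. cnj (v \<alpha>) * alg_down D Q H v X)"
    by (intro sum.cong refl) (simp add: quot_memberD)
  also have "\<dots> = (\<Sum>X\<in>carrier E. cnj (alg_down D Q H v X) * alg_down D Q H v X)"
    by (intro sum.cong refl) (simp add: alg_down_def sum_distrib_right)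
  also have "\<dots> = of_real (\<Sum>X\<in>carrier E. (norm (alg_down D Q H v X))\<^sup>2)"
    by (simp only: of_real_sum complex_norm_square mult.commute)
  finally show ?thesis .
qed

end

section \<open>Oldforms\<close>

context discriminant_form
begin

definition nontrivial_isotropics :: "'a set set"
  where "nontrivial_isotropics = {H. isotropic D Q H \<and> H \<noteq> {\<one>}}"

text \<open>The operator P of the overview.\<close>

definition old_operator :: "('a \<Rightarrow> complex) \<Rightarrow> 'a \<Rightarrow> complex"
  where "old_operator v = (\<lambda>\<alpha>. \<Sum>H\<in>nontrivial_isotropics. alg_up D Q H (alg_down D Q H v) \<alpha>)"

lemma isotropic_subgroupI: "H \<in> nontrivial_isotropics \<Longrightarrow> isotropic_subgroup D Q H"
  by unfold_locales (simp add: nontrivial_isotropics_def)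

lemma finite_nontrivial_isotropics: "finite nontrivial_isotropics"
proof (rule finite_subset)
  show "nontrivial_isotropics \<subseteq> Pow (carrier D)"
    by (auto simp: nontrivial_isotropics_def isotropic_def dest: subgroup.mem_carrier)
qed (simp add: finite_carrier)

lemma algebra_linear_old_operator: "algebra_linear D old_operator"
  unfolding algebra_linear_def old_operator_def
  by (simp add: algebra_linearD [OF algebra_linear_alg_down] alg_down_in_group_algebra
      alg_up_lincomb sum.distrib sum_distrib_left)

lemma old_operator_in_group_algebra: "old_operator v \<in> group_algebra D"
  unfolding old_operator_def by (intro group_algebra_sum alg_up_in_group_algebra)

text \<open>Each summand passes through the representation \<open>quot_rep\<close> of its
  quotient.\<close>

lemma old_operator_commutes:
  assumes weil: "weil_representation D Q \<rho>" and "M \<in> SL2Z" "v \<in> group_algebra D"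
  shows "old_operator (\<rho> M v) = \<rho> M (old_operator v)"
proof -
  have "alg_up D Q H (alg_down D Q H (\<rho> M v)) = \<rho> M (alg_up D Q H (alg_down D Q H v))"
    if "H \<in> nontrivial_isotropics" for H
  proof -
    interpret isotropic_subgroup D Q H by (rule isotropic_subgroupI [OF that])
    show ?thesis
      using assms by (simp add: down_quot_rep up_quot_rep alg_down_in_group_algebra)
  qed
  then show ?thesis
    unfolding old_operator_def
    using algebra_linear_sum [OF weil_representationD(2) [OF weil assms(2)] finite_nontrivial_isotropics,
        of "\<lambda>H. alg_up D Q H (alg_down D Q H v)"]
    by (simp add: alg_up_in_group_algebra)
qed

text \<open>Pairing P v with v gives the sum over H of the squared norms of
  \<open>alg_down D Q H v\<close>; if it is 0, every term is.\<close>

lemma old_operator_kernel: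
  assumes "old_operator v = (\<lambda>_. 0)" "H \<in> nontrivial_isotropics"
  shows "alg_down D Q H v = (\<lambda>_. 0)"
proof -
  define N where "N = (\<lambda>H. \<Sum>X\<in>carrier (quot_group D Q H). (norm (alg_down D Q H v X))\<^sup>2)"
  have "of_real (\<Sum>H\<in>nontrivial_isotropics. N H) =
      (\<Sum>H\<in>nontrivial_isotropics. \<Sum>\<alpha>\<in>carrier D. cnj (v \<alpha>) * alg_up D Q H (alg_down D Q H v) \<alpha>)"
    unfolding of_real_sum N_def
    by (intro sum.cong refl, subst isotropic_subgroup.down_adjoint_up) (auto intro: isotropic_subgroupI)
  also have "\<dots> = (\<Sum>\<alpha>\<in>carrier D. cnj (v \<alpha>) * old_operator v \<alpha>)"
    unfolding old_operator_def sum_distrib_left by (rule sum.swap)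
  also have "\<dots> = 0"
    using assms(1) by simp
  finally have "(\<Sum>H\<in>nontrivial_isotropics. N H) = 0"
    by (simp only: of_real_eq_0_iff)
  then have "N H = 0"
    using assms(2) finite_nontrivial_isotropics
    by (subst (asm) sum_nonneg_eq_0_iff) (auto simp: N_def intro!: sum_nonneg)
  moreover have "finite (carrier (quot_group D Q H))"
    using assms(2) by (intro isotropic_subgroup.finite_quot isotropic_subgroupI)
  ultimately have "\<forall>X\<in>carrier (quot_group D Q H). alg_down D Q H v X = 0"
    unfolding N_def by (subst (asm) sum_nonneg_eq_0_iff) auto
  then show ?thesis
    by (auto simp: alg_down_def)
qed

lemma up_lift_eq: "up_lift D Q H G \<tau> = alg_up D Q H (G \<tau>)"
proof -
  have "finite (perp D Q H)"
    using finite_carrier by (rule rev_finite_subset) (auto simp: perp_def)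
  then show ?thesis
    by (simp add: up_lift_def alg_up_def basis_vec_def if_distrib cong: if_cong)
qed

text \<open>The hypothesis makes P injective by \<open>old_operator_kernel\<close>, hence bijective
  on the group algebra. Its inverse R commutes with the Weil representation, and applying P to R(F)
  writes F as the sum of the lifts of \<open>alg_down D Q H (R (F \<tau>))\<close>.\<close>

lemma oldform_if_down_injective:
  assumes inj: "\<And>v. v \<in> group_algebra D \<Longrightarrow>
      (\<And>H. H \<in> nontrivial_isotropics \<Longrightarrow> alg_down D Q H v = (\<lambda>_. 0)) \<Longrightarrow> v = (\<lambda>_. 0)"
    and F: "F \<in> modular_forms k D Q"
  shows "oldform k D Q F"
proof -
  have ker: "v = (\<lambda>_. 0)" if "v \<in> group_algebra D" "old_operator v = (\<lambda>_. 0)" for v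
    using that old_operator_kernel by (intro inj) auto
  have uniq: "v = w"
    if vw: "v \<in> group_algebra D" "w \<in> group_algebra D" "old_operator v = old_operator w" for v w
  proof -
    have "old_operator (\<lambda>\<gamma>. 1 * v \<gamma> + (- 1) * w \<gamma>) =
        (\<lambda>\<gamma>. 1 * old_operator v \<gamma> + (- 1) * old_operator w \<gamma>)"
      by (rule algebra_linearD [OF algebra_linear_old_operator vw(1,2)])
    also have "\<dots> = (\<lambda>_. 0)"
      using vw by simp
    finally have "(\<lambda>\<gamma>. 1 * v \<gamma> + (- 1) * w \<gamma>) = (\<lambda>_. 0)"
      by (rule ker [OF group_algebra_lincomb [OF vw(1,2)]])
    then show ?thesis by (simp add: fun_eq_iff)
  qed
  have "\<forall>u\<in>group_algebra D. \<exists>v\<in>group_algebra D. old_operator v = u"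
    using algebra_linear_inj_imp_surj [OF finite_carrier algebra_linear_old_operator
        old_operator_in_group_algebra ker] by blast
  then obtain R where R: "\<And>u. u \<in> group_algebra D \<Longrightarrow> R u \<in> group_algebra D"
    "\<And>u. u \<in> group_algebra D \<Longrightarrow> old_operator (R u) = u"
    by metis
  \<comment> \<open>R is obtained by pointwise choice, so linearity and equivariance are checked by
    applying P to both sides and cancelling it with \<open>uniq\<close>.\<close>
  have linR: "algebra_linear D R"
    unfolding algebra_linear_def
  proof (intro ballI allI)
    fix v w a b assume vw: "v \<in> group_algebra D" "w \<in> group_algebra D"
    show "R (\<lambda>\<gamma>. a * v \<gamma> + b * w \<gamma>) = (\<lambda>\<gamma>. a * R v \<gamma> + b * R w \<gamma>)"
    proof (rule uniq)
      show "old_operator (R (\<lambda>\<gamma>. a * v \<gamma> + b * w \<gamma>)) =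
          old_operator (\<lambda>\<gamma>. a * R v \<gamma> + b * R w \<gamma>)"
        unfolding algebra_linearD [OF algebra_linear_old_operator R(1) [OF vw(1)] R(1) [OF vw(2)]]
        using R(2) vw group_algebra_lincomb [OF vw] by simp
    qed (intro R group_algebra_lincomb vw)+
  qed
  have R_comm: "R (\<rho> M v) = \<rho> M (R v)"
    if "weil_representation D Q \<rho>" "M \<in> SL2Z" "v \<in> group_algebra D" for \<rho> M v
  proof (rule uniq)
    show "old_operator (R (\<rho> M v)) = old_operator (\<rho> M (R v))"
      using that by (simp add: R old_operator_commutes weil_representationD(1) [OF that(1)])
  qed (intro R weil_representationD(1) [OF that(1)] that)+
  define G where "G = (\<lambda>H \<tau>. alg_down D Q H (R (F \<tau>)))"
  have "G H \<in> modular_forms k (quot_group D Q H) (quot_form Q)"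
    if H: "H \<in> nontrivial_isotropics" for H
  proof -
    interpret isotropic_subgroup D Q H by (rule isotropic_subgroupI [OF H])
    show ?thesis
      unfolding G_def
    proof (rule modular_forms_map [OF finite_carrier finite_quot F, where L = "\<lambda>v. alg_down D Q H (R v)"])
      show "algebra_linear D (\<lambda>v. alg_down D Q H (R v))"
        unfolding algebra_linear_def
        by (simp add: algebra_linearD [OF linR] algebra_linearD [OF algebra_linear_alg_down] R(1))
      show "alg_down D Q H (R v) \<in> group_algebra E" for v
        by (rule alg_down_in_group_algebra)
      fix \<rho> assume \<rho>: "weil_representation D Q \<rho>"
      show "\<exists>\<rho>'. weil_representation E q \<rho>' \<and>
          (\<forall>M\<in>SL2Z. \<forall>v\<in>group_algebra D. alg_down D Q H (R (\<rho> M v)) = \<rho>' M (alg_down D Q H (R v)))"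
        using weil_representation_quot [OF \<rho>] R(1)
        by (intro exI [of _ "quot_rep \<rho>"]) (simp add: R_comm [OF \<rho>] down_quot_rep [OF \<rho>])
    qed
  qed
  moreover have "F \<tau> = (\<lambda>\<alpha>. \<Sum>H\<in>nontrivial_isotropics. up_lift D Q H (G H) \<tau> \<alpha>)"
    if "\<tau> \<in> upper_half_plane" for \<tau>
  proof -
    have "F \<tau> \<in> group_algebra D"
      using F that by (simp add: modular_forms_def)
    then have "F \<tau> = old_operator (R (F \<tau>))"
      by (simp add: R(2))
    then show ?thesis
      by (simp add: old_operator_def up_lift_eq G_def)
  qed
  ultimately show ?thesis
    unfolding oldform_def nontrivial_isotropics_def by (intro exI [of _ G]) blast
qed

end

theorem theorem7p2:
  fixes D :: "'a monoid" and Q :: "'a \<Rightarrow> rat_mod_int" and cs :: "'a jordan_component list"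
  assumes "discriminant_form D Q"
    and "even_signature D Q"
    and "jordan_splitting D Q cs"
    and "(\<exists>p. prime p \<and> odd p \<and> odd_prime_rank cs p 1 \<ge> 7)
      \<or> (\<exists>p j. prime p \<and> odd p \<and> j > 1 \<and> odd_prime_rank cs p j \<ge> 4)
      \<or> (\<exists>j \<in> {1, 2}. even_two_rank cs j + odd_two_rank cs j \<ge> 9)
      \<or> (\<exists>j \<ge> 3. even_two_rank cs j + odd_two_rank cs j \<ge> 5)"
  shows "\<forall>k :: int. \<forall>F \<in> modular_forms k D Q. oldform k D Q F"
proof (intro allI ballI)
  fix k F assume F: "F \<in> modular_forms k D Q"
  interpret discriminant_form D Q by (rule assms(1))
  obtain p where p: "prime p" and iso: "\<And>g. g \<in> carrier D \<Longrightarrow>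
      \<exists>I. isotropic D Q I \<and> g \<in> perp D Q I \<and> (\<forall>u\<in>I. u [^]\<^bsub>D\<^esub> p = \<one>\<^bsub>D\<^esub>) \<and> card I > p"
    using exists_isotropic_subgroup_of_large_rank [OF assms(3,4)] by blast
  show "oldform k D Q F"
  proof (rule oldform_if_down_injective [OF _ F])
    fix v :: "'a \<Rightarrow> complex"
    assume v: "v \<in> group_algebra D"
      and down: "\<And>H. H \<in> nontrivial_isotropics \<Longrightarrow> alg_down D Q H v = (\<lambda>_. 0)"
    have "v g = 0" if g: "g \<in> carrier D" for g
    proof -
      obtain I where I: "isotropic D Q I" "g \<in> perp D Q I"
        "\<forall>u\<in>I. u [^]\<^bsub>D\<^esub> p = \<one>\<^bsub>D\<^esub>" "card I > p"
        using iso [OF g] by blast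
      show ?thesis
      proof (rule vanishing_from_isotropic_sums [OF p I(1,2) _ I(4)])
        fix H assume H: "isotropic D Q H" "H \<noteq> {\<one>\<^bsub>D\<^esub>}" "g \<in> perp D Q H"
        then have H': "H \<in> nontrivial_isotropics"
          by (simp add: nontrivial_isotropics_def)
        interpret isotropic_subgroup D Q H by (rule isotropic_subgroupI [OF H'])
        \<comment> \<open>The sums needed for the vanishing criterion are the values of
          \<open>alg_down\<close> at the cosets of g.\<close>
        have "(\<Sum>h\<in>H. v (h \<otimes>\<^bsub>D\<^esub> g)) = alg_down D Q H v (H #>\<^bsub>D\<^esub> g)"
          using sum_coset [OF g, of v] coset_in_quot [OF H(3)] by (simp add: alg_down_def)
        then show "(\<Sum>h\<in>H. v (h \<otimes>\<^bsub>D\<^esub> g)) = 0"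
          by (simp add: down [OF H'])
      qed (use I(3) in blast)
    qed
    then show "v = (\<lambda>_. 0)"
      using v by (auto simp: group_algebra_def fun_eq_iff)
  qed
qed

end
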